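(* Let $\tau=(B,R,p,s)$ be a quaternionic type and let $\alpha\in B$ be an element having an infinite continued fraction expansion $[a_0,a_1,a_2,\ldots]$ of type $\tau$. Assume that there exists an eventual upper bound $\mu_\alpha$ for the sequence $$\left\{\frac{\theta(N_\infty(a_n))}{|a_n|_p}\right\}_{n\in\mathbb{N}},$$ i.e. a real number $\mu_\alpha$ such that $\theta(N_\infty(a_n))/|a_n|_p\le \mu_\alpha$ for all sufficiently large $n$. Then $\mu_\alpha\ge 1$.
   Context: Quaternionic type: a quadruple $(B,R,p,s)$ where $B$ is a division quaternion algebra over $\mathbb{Q}$; $p$ is an odd prime at which $B$ is ramified, i.e. $B_p:=B\otimes_{\mathbb{Q}}\mathbb{Q}_p$ is a division algebra; $R$ is an order in $B$; and $s$ is a $p$-adic floor function for $(B,R)$. For a prime $q$ put $B_q=B\otimes_{\mathbb{Q}}\mathbb{Q}_q$ and $R_q=R\otimes_{\mathbb{Z}}\mathbb{Z}_q\subset B_q$. On $B_p$ use the non-archimedean absolute value $|\alpha|_p=p^{-w_p(\alpha)}$, $w_p(\alpha)=v_p(\mathrm{nrd}(\alpha))/2$, with $\mathrm{nrd}$ the reduced norm. A $p$-adic floor function for $(B,R)$ is a map $s:B_p\to B$ such that: $|\alpha-s(\alpha)|_p<1$ for all $\alpha\in B_p$; $s(\alpha)\in R_q$ for every prime $q\ne p$; $s(0)=0$; and $s(\alpha)=s(\beta)$ whenever $|\alpha-\beta|_p<1$. The continued fraction expansion of type $\tau$ of $\alpha_0\in B_p$ is the (finite or infinite) sequence $[a_0,a_1,\dots]$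 produced by $a_n=s(\alpha_n)$, $\alpha_{n+1}=(\alpha_n-a_n)^{-1}$ if $\alpha_n\ne a_n$, the algorithm stopping if $\alpha_n=a_n$. (One has $|a_n|_p>1$ for $n\ge1$.) $N_\infty$ is the operator norm (with respect to the Euclidean norm on vectors) on $B_\infty=B\otimes_{\mathbb{Q}}\mathbb{R}$, after fixing an isomorphism $B_\infty\cong M_2(\mathbb{R})$ if $B$ is indefinite, or an embedding of $B_\infty$ (the real Hamilton quaternions) in $M_2(\mathbb{C})$ if $B$ is definite. For $x\in\mathbb{C}$, $\theta(x)=\frac12\left(|x|_\infty+\sqrt{|x|_\infty^2+4}\right)$, where $|\cdot|_\infty$ is the usual absolute value. *)

theory Defs
  imports
    "HOL-Analysis.Analysis"
    "HOL-Algebra.Algebraic_Closure_Type"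
    "HOL-Computational_Algebra.Primes"
begin

section \<open>p-adic numbers\<close>

definition padic_val_rat :: "nat \<Rightarrow> rat \<Rightarrow> int" where
  "padic_val_rat p x =
     (case quotient_of x of (m, d) \<Rightarrow>
        int (multiplicity (int p) m) - int (multiplicity (int p) d))"

definition padic_abs_rat :: "nat \<Rightarrow> rat \<Rightarrow> real" where
  "padic_abs_rat p x = (if x = 0 then 0 else real p powi (- padic_val_rat p x))"

definition padic_Cauchy :: "nat \<Rightarrow> (nat \<Rightarrow> rat) set" where
  "padic_Cauchy p =
     {f. \<forall>e>0. \<exists>N. \<forall>m\<ge>N. \<forall>n\<ge>N. padic_abs_rat p (f m - f n) < e}"

definition padic_null :: "nat \<Rightarrow> (nat \<Rightarrow> rat) set" where
  "padic_null p = {f. (\<lambda>n. padic_abs_rat p (f n)) \<longlonglongrightarrow> 0}"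

definition padic_Cauchy_ring :: "nat \<Rightarrow> (nat \<Rightarrow> rat) ring" where
  "padic_Cauchy_ring p =
     \<lparr>carrier = padic_Cauchy p, monoid.mult = (\<lambda>f g n. f n * g n), one = (\<lambda>n. 1),
      ring.zero = (\<lambda>n. 0), add = (\<lambda>f g n. f n + g n)\<rparr>"

type_synonym padic = "(nat \<Rightarrow> rat) set"

text \<open>The field of p-adic numbers is the completion of the rationals: Cauchy sequences modulo
  null sequences. Its elements all live in one type, independently of the prime, so that one can
  quantify over all primes inside a formula.\<close>

definition Qp :: "nat \<Rightarrow> padic ring" where
  "Qp p = padic_Cauchy_ring p Quot padic_null p"

definition padic_of_rat :: "nat \<Rightarrow> rat \<Rightarrow> padic" where
  "padic_of_rat p x = padic_null p +>\<^bsub>padic_Cauchy_ring p\<^esub> (\<lambda>n. x)"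

text \<open>The valuation of a nonzero p-adic number is the eventually constant valuation of any
  Cauchy sequence representing it. The value at zero (which should be infinity) is irrelevant:
  zero is always treated separately below.\<close>

definition padic_val :: "nat \<Rightarrow> padic \<Rightarrow> int" where
  "padic_val p x =
     (THE k. \<forall>f\<in>x. \<forall>\<^sub>F n in sequentially. f n \<noteq> 0 \<and> padic_val_rat p (f n) = k)"

definition Zp :: "nat \<Rightarrow> padic set" where
  "Zp p = {x \<in> carrier (Qp p). x = \<zero>\<^bsub>Qp p\<^esub> \<or> padic_val p x \<ge> 0}"


section \<open>Quaternion algebras\<close>

datatype 'k quat = Quat (q_one: 'k) (q_i: 'k) (q_j: 'k) (q_k: 'k)

text \<open>The quaternion algebra (a, b | K), with K-basis 1, i, j, k, where \<open>i\<^sup>2 = a\<close>, \<open>j\<^sup>2 = b\<close>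
  and \<open>k = ij = -ji\<close>. Every quaternion algebra over a field of characteristic different from 2
  is of this form with nonzero a and b.\<close>

definition quat_alg :: "'k ring \<Rightarrow> 'k \<Rightarrow> 'k \<Rightarrow> ('k, 'k quat) module" where
  "quat_alg K a b =
    \<lparr>carrier = {x. set_quat x \<subseteq> carrier K},
     monoid.mult = (\<lambda>x y. case x of Quat x0 x1 x2 x3 \<Rightarrow> case y of Quat y0 y1 y2 y3 \<Rightarrow>
       Quat
        (x0 \<otimes>\<^bsub>K\<^esub> y0 \<oplus>\<^bsub>K\<^esub> a \<otimes>\<^bsub>K\<^esub> (x1 \<otimes>\<^bsub>K\<^esub> y1) \<oplus>\<^bsub>K\<^esub> b \<otimes>\<^bsub>K\<^esub> (x2 \<otimes>\<^bsub>K\<^esub> y2)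
           \<ominus>\<^bsub>K\<^esub> a \<otimes>\<^bsub>K\<^esub> b \<otimes>\<^bsub>K\<^esub> (x3 \<otimes>\<^bsub>K\<^esub> y3))
        (x0 \<otimes>\<^bsub>K\<^esub> y1 \<oplus>\<^bsub>K\<^esub> x1 \<otimes>\<^bsub>K\<^esub> y0 \<oplus>\<^bsub>K\<^esub> b \<otimes>\<^bsub>K\<^esub> (x3 \<otimes>\<^bsub>K\<^esub> y2) \<ominus>\<^bsub>K\<^esub> b \<otimes>\<^bsub>K\<^esub> (x2 \<otimes>\<^bsub>K\<^esub> y3))
        (x0 \<otimes>\<^bsub>K\<^esub> y2 \<oplus>\<^bsub>K\<^esub> x2 \<otimes>\<^bsub>K\<^esub> y0 \<oplus>\<^bsub>K\<^esub> a \<otimes>\<^bsub>K\<^esub> (x1 \<otimes>\<^bsub>K\<^esub> y3) \<ominus>\<^bsub>K\<^esub> a \<otimes>\<^bsub>K\<^esub> (x3 \<otimes>\<^bsub>K\<^esub> y1))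
        (x0 \<otimes>\<^bsub>K\<^esub> y3 \<oplus>\<^bsub>K\<^esub> x3 \<otimes>\<^bsub>K\<^esub> y0 \<oplus>\<^bsub>K\<^esub> x1 \<otimes>\<^bsub>K\<^esub> y2 \<ominus>\<^bsub>K\<^esub> x2 \<otimes>\<^bsub>K\<^esub> y1)),
     one = Quat \<one>\<^bsub>K\<^esub> \<zero>\<^bsub>K\<^esub> \<zero>\<^bsub>K\<^esub> \<zero>\<^bsub>K\<^esub>,
     ring.zero = Quat \<zero>\<^bsub>K\<^esub> \<zero>\<^bsub>K\<^esub> \<zero>\<^bsub>K\<^esub> \<zero>\<^bsub>K\<^esub>,
     add = (\<lambda>x y. case x of Quat x0 x1 x2 x3 \<Rightarrow> case y of Quat y0 y1 y2 y3 \<Rightarrow>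
       Quat (x0 \<oplus>\<^bsub>K\<^esub> y0) (x1 \<oplus>\<^bsub>K\<^esub> y1) (x2 \<oplus>\<^bsub>K\<^esub> y2) (x3 \<oplus>\<^bsub>K\<^esub> y3)),
     smult = (\<lambda>c. map_quat (\<lambda>x. c \<otimes>\<^bsub>K\<^esub> x))\<rparr>"

text \<open>The product of \<open>x\<close> with its conjugate.\<close>

definition nrd :: "'k ring \<Rightarrow> 'k \<Rightarrow> 'k \<Rightarrow> 'k quat \<Rightarrow> 'k" where
  "nrd K a b x = (case x of Quat x0 x1 x2 x3 \<Rightarrow>
     x0 \<otimes>\<^bsub>K\<^esub> x0 \<ominus>\<^bsub>K\<^esub> a \<otimes>\<^bsub>K\<^esub> (x1 \<otimes>\<^bsub>K\<^esub> x1) \<ominus>\<^bsub>K\<^esub> b \<otimes>\<^bsub>K\<^esub> (x2 \<otimes>\<^bsub>K\<^esub> x2)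
       \<oplus>\<^bsub>K\<^esub> a \<otimes>\<^bsub>K\<^esub> b \<otimes>\<^bsub>K\<^esub> (x3 \<otimes>\<^bsub>K\<^esub> x3))"

definition is_division_ring :: "('a, 'm) ring_scheme \<Rightarrow> bool" where
  "is_division_ring D \<longleftrightarrow> ring D \<and> Units D = carrier D - {\<zero>\<^bsub>D\<^esub>}"

text \<open>All linear combinations of elements of \<open>S\<close> with coefficients in \<open>C\<close>.\<close>

definition lin_combs :: "('k, 'v) module \<Rightarrow> 'k set \<Rightarrow> 'v set \<Rightarrow> 'v set" where
  "lin_combs V C S =
     {v. \<exists>(n::nat) c x. (\<forall>i<n. c i \<in> C \<and> x i \<in> S) \<and> v = (\<Oplus>\<^bsub>V\<^esub>i\<in>{..<n}. c i \<odot>\<^bsub>V\<^esub> x i)}"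

text \<open>For a quaternion algebra B = (a, b | Q), its scalar extensions are the algebras
  \<open>(a, b | K)\<close> with the same structure constants.\<close>

definition BQ :: "rat \<Rightarrow> rat \<Rightarrow> (rat, rat quat) module" where
  "BQ a b = quat_alg ring_of_type_algebra a b"

definition Bp :: "rat \<Rightarrow> rat \<Rightarrow> nat \<Rightarrow> (padic, padic quat) module" where
  "Bp a b p = quat_alg (Qp p) (padic_of_rat p a) (padic_of_rat p b)"

definition Binf :: "rat \<Rightarrow> rat \<Rightarrow> (real, real quat) module" where
  "Binf a b = quat_alg ring_of_type_algebra (of_rat a) (of_rat b)"

abbreviation to_Bp :: "nat \<Rightarrow> rat quat \<Rightarrow> padic quat" where
  "to_Bp p \<equiv> map_quat (padic_of_rat p)"

abbreviation to_Binf :: "rat quat \<Rightarrow> real quat" where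
  "to_Binf \<equiv> map_quat of_rat"

text \<open>An order is a subring that is a full lattice.\<close>

definition quat_order :: "rat \<Rightarrow> rat \<Rightarrow> rat quat set \<Rightarrow> bool" where
  "quat_order a b R \<longleftrightarrow>
     subring R (BQ a b) \<and>
     (\<exists>S. finite S \<and> S \<subseteq> carrier (BQ a b) \<and> R = lin_combs (BQ a b) \<int> S) \<and>
     lin_combs (BQ a b) UNIV R = carrier (BQ a b)"

text \<open>The image of the tensor product of \<open>R\<close> with the q-adic integers in \<open>Bp a b q\<close>.\<close>

definition order_completion :: "rat \<Rightarrow> rat \<Rightarrow> rat quat set \<Rightarrow> nat \<Rightarrow> padic quat set" where
  "order_completion a b R q = lin_combs (Bp a b q) (Zp q) (to_Bp q ` R)"

definition w_Bp :: "rat \<Rightarrow> rat \<Rightarrow> nat \<Rightarrow> padic quat \<Rightarrow> real" where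
  "w_Bp a b p x =
     real_of_int (padic_val p (nrd (Qp p) (padic_of_rat p a) (padic_of_rat p b) x)) / 2"

definition abs_Bp :: "rat \<Rightarrow> rat \<Rightarrow> nat \<Rightarrow> padic quat \<Rightarrow> real" where
  "abs_Bp a b p x =
     (if nrd (Qp p) (padic_of_rat p a) (padic_of_rat p b) x = \<zero>\<^bsub>Qp p\<^esub> then 0
      else real p powr (- w_Bp a b p x))"


section \<open>Quaternionic types and continued fractions\<close>

definition padic_floor ::
    "rat \<Rightarrow> rat \<Rightarrow> rat quat set \<Rightarrow> nat \<Rightarrow> (padic quat \<Rightarrow> rat quat) \<Rightarrow> bool" where
  "padic_floor a b R p s \<longleftrightarrow>
     (\<forall>\<alpha>\<in>carrier (Bp a b p). s \<alpha> \<in> carrier (BQ a b)) \<and>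
     (\<forall>\<alpha>\<in>carrier (Bp a b p). abs_Bp a b p (\<alpha> \<ominus>\<^bsub>Bp a b p\<^esub> to_Bp p (s \<alpha>)) < 1) \<and>
     (\<forall>\<alpha>\<in>carrier (Bp a b p). \<forall>q. Factorial_Ring.prime q \<and> q \<noteq> p \<longrightarrow>
        to_Bp q (s \<alpha>) \<in> order_completion a b R q) \<and>
     s \<zero>\<^bsub>Bp a b p\<^esub> = \<zero>\<^bsub>BQ a b\<^esub> \<and>
     (\<forall>\<alpha>\<in>carrier (Bp a b p). \<forall>\<beta>\<in>carrier (Bp a b p).
        abs_Bp a b p (\<alpha> \<ominus>\<^bsub>Bp a b p\<^esub> \<beta>) < 1 \<longrightarrow> s \<alpha> = s \<beta>)"

text \<open>The algebra B is given by its structure constants \<open>a\<close> and \<open>b\<close>.\<close>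

definition quaternionic_type ::
    "rat \<Rightarrow> rat \<Rightarrow> rat quat set \<Rightarrow> nat \<Rightarrow> (padic quat \<Rightarrow> rat quat) \<Rightarrow> bool" where
  "quaternionic_type a b R p s \<longleftrightarrow>
     a \<noteq> 0 \<and> b \<noteq> 0 \<and> is_division_ring (BQ a b) \<and>
     Factorial_Ring.prime p \<and> odd p \<and> is_division_ring (Bp a b p) \<and>
     quat_order a b R \<and> padic_floor a b R p s"

text \<open>The complete quotients of \<open>\<alpha>\<close>; \<open>None\<close> means that the algorithm has already stopped.\<close>

fun complete_quotient ::
    "rat \<Rightarrow> rat \<Rightarrow> nat \<Rightarrow> (padic quat \<Rightarrow> rat quat) \<Rightarrow> padic quat \<Rightarrow> nat \<Rightarrow> padic quat option" where
  "complete_quotient a b p s \<alpha> 0 = Some \<alpha>"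
| "complete_quotient a b p s \<alpha> (Suc n) =
     (case complete_quotient a b p s \<alpha> n of
        None \<Rightarrow> None
      | Some x \<Rightarrow>
          if x = to_Bp p (s x) then None
          else Some (inv\<^bsub>Bp a b p\<^esub> (x \<ominus>\<^bsub>Bp a b p\<^esub> to_Bp p (s x))))"

definition partial_quotient ::
    "rat \<Rightarrow> rat \<Rightarrow> nat \<Rightarrow> (padic quat \<Rightarrow> rat quat) \<Rightarrow> padic quat \<Rightarrow> nat \<Rightarrow> rat quat option" where
  "partial_quotient a b p s \<alpha> n = map_option s (complete_quotient a b p s \<alpha> n)"

text \<open>The continued fraction expansion of \<open>\<alpha>\<close> is infinite and equal to \<open>[c 0, c 1, ...]\<close>.\<close>

definition has_infinite_cf ::
    "rat \<Rightarrow> rat \<Rightarrow> nat \<Rightarrow> (padic quat \<Rightarrow> rat quat) \<Rightarrow> padic quat \<Rightarrow> (nat \<Rightarrow> rat quat) \<Rightarrow> bool" where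
  "has_infinite_cf a b p s \<alpha> c \<longleftrightarrow> (\<forall>n. partial_quotient a b p s \<alpha> n = Some (c n))"


section \<open>The archimedean norm\<close>

definition matrix_rep ::
    "(real, 'v) module \<Rightarrow> ('v \<Rightarrow> 'c::real_normed_field ^ 2 ^ 2) \<Rightarrow> bool" where
  "matrix_rep A \<phi> \<longleftrightarrow>
     (\<forall>x\<in>carrier A. \<forall>y\<in>carrier A. \<phi> (x \<oplus>\<^bsub>A\<^esub> y) = \<phi> x + \<phi> y) \<and>
     (\<forall>x\<in>carrier A. \<forall>y\<in>carrier A. \<phi> (x \<otimes>\<^bsub>A\<^esub> y) = \<phi> x ** \<phi> y) \<and>
     (\<forall>c. \<forall>x\<in>carrier A. \<phi> (c \<odot>\<^bsub>A\<^esub> x) = c *\<^sub>R \<phi> x) \<and>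
     \<phi> \<one>\<^bsub>A\<^esub> = mat 1"

text \<open>Quaternion algebras over the reals are either division algebras (isomorphic to Hamilton's
  quaternions; then B is called definite) or isomorphic to the algebra of real 2 by 2 matrices
  (then B is called indefinite).\<close>

definition definite :: "rat \<Rightarrow> rat \<Rightarrow> bool" where
  "definite a b \<longleftrightarrow> is_division_ring (Binf a b)"

text \<open>\<open>N\<close> is the operator norm on \<open>Binf a b\<close> that belongs to some choice of the isomorphism
  (indefinite case) or embedding (definite case) into matrices.\<close>

definition archimedean_norm :: "rat \<Rightarrow> rat \<Rightarrow> (real quat \<Rightarrow> real) \<Rightarrow> bool" where
  "archimedean_norm a b N \<longleftrightarrow>
     (if definite a b
      then \<exists>\<phi> :: real quat \<Rightarrow> complex ^ 2 ^ 2.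
             matrix_rep (Binf a b) \<phi> \<and> inj_on \<phi> (carrier (Binf a b)) \<and>
             (\<forall>x\<in>carrier (Binf a b). N x = onorm (\<lambda>v. \<phi> x *v v))
      else \<exists>\<phi> :: real quat \<Rightarrow> real ^ 2 ^ 2.
             matrix_rep (Binf a b) \<phi> \<and> bij_betw \<phi> (carrier (Binf a b)) UNIV \<and>
             (\<forall>x\<in>carrier (Binf a b). N x = onorm (\<lambda>v. \<phi> x *v v)))"

definition theta :: "complex \<Rightarrow> real" where
  "theta x = (cmod x + sqrt ((cmod x)\<^sup>2 + 4)) / 2"

end

theory Submission
  imports Defs
begin

text \<open>
The theorem is a product formula argument. Let \<open>x n\<close> be the complete quotients of \<open>\<alpha>\<close>, and let
\<open>\<xi> 0 = \<alpha>\<close>, \<open>\<xi> 1 = 1\<close>, \<open>\<xi> (n + 2) = \<xi> n - c n \<xi> (n + 1)\<close> be the remainders of the Euclidean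
algorithm (\<open>remainder\<close>). Then \<open>x n \<xi> (n + 1) = \<xi> n\<close>, so that no remainder with positive index
vanishes. The sizes of the remainders are estimated at all places.

At \<open>p\<close>, the quotient of \<open>|\<xi> n|\<close> and \<open>|\<xi> (n + 1)|\<close> is \<open>|x n|\<close>, which equals \<open>|c n|\<close> for
\<open>n \<ge> 1\<close>. The equality needs the ultrametric inequality for the norm of the division algebra
at \<open>p\<close> (\<open>av_qnrd_add_le_max\<close>). Its core is that an element of integral reduced norm has integral
reduced trace (\<open>av_trace_le_1\<close>): otherwise Hensel's lemma would split its minimal polynomial.

At infinity, the operator norms satisfy \<open>N (\<xi> (n + 2)) \<le> N (\<xi> n) + N (c n) N (\<xi> (n + 1))\<close>, so
the Euclidean length \<open>t n\<close> of the vector of two consecutive norms grows at most by the factor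
\<open>theta (N (c n))\<close> (\<open>continuant_step\<close>). The absolute value of the reduced norm is at most the square
of the operator norm, since the reduced norm is the determinant of the representing matrix
(\<open>det_rep\<close>, \<open>norm_det_le_onorm_squared\<close>).

At the primes \<open>q \<noteq> p\<close>, the partial quotients lie in the completions of \<open>R\<close>. Being rational, they
lie in the localizations of \<open>R\<close> (\<open>R_at_if_in_order_completion\<close>), hence in \<open>R[1/p]\<close>
(\<open>R_away_if_R_at\<close>). So all remainders lie in a fixed multiple of \<open>R[1/p]\<close>, and there the product of
the p-adic and the usual absolute value of a nonzero reduced norm is bounded below by a positive
constant (\<open>R_away_product_formula\<close>).

Together, \<open>|\<xi> n| t n\<close> is bounded below, while its growth in step \<open>n\<close> is at most
\<open>theta (N (c n)) / |c n|\<close>, which is eventually at most \<open>\<mu>\<close>. Therefore \<open>\<mu>\<close> cannot be smaller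
than 1.

All computations take place in the rational algebra: it is dense in each of its completions, whose
elements are handled through sequences of rational quaternions.
\<close>

section \<open>The p-adic absolute value on the rationals\<close>

lemma padic_val_rat_quotient:
  fixes m d :: int
  assumes "Factorial_Ring.prime p" "m \<noteq> 0" "d \<noteq> 0"
  shows "padic_val_rat p (of_int m / of_int d) =
           int (multiplicity (int p) m) - int (multiplicity (int p) d)"
proof -
  obtain m' d' where q: "quotient_of (of_int m / of_int d) = (m', d')"
    by fastforce
  have pr: "prime_elem (int p)"
    using assms(1) by auto
  have d': "d' \<noteq> 0"
    using quotient_of_denom_pos[OF q] by simp
  have eq: "(of_int m / of_int d :: rat) = of_int m' / of_int d'"
    using quotient_of_div[OF q] .
  with assms d' have m': "m' \<noteq> 0"
    by auto
  from eq have "(of_int (m * d') :: rat) = of_int (m' * d)"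
    using assms d' by (simp add: frac_eq_eq)
  then have "m * d' = m' * d"
    by (simp only: of_int_eq_iff)
  then have "multiplicity (int p) (m * d') = multiplicity (int p) (m' * d)"
    by simp
  then have "multiplicity (int p) m + multiplicity (int p) d' =
      multiplicity (int p) m' + multiplicity (int p) d"
    using pr assms d' m' by (simp add: prime_elem_multiplicity_mult_distrib)
  then show ?thesis
    unfolding padic_val_rat_def q by simp
qed

locale padic_prime =
  fixes p :: nat
  assumes prime_p: "Factorial_Ring.prime p"
begin

abbreviation av :: "rat \<Rightarrow> real" where
  "av \<equiv> padic_abs_rat p"

lemma p_gt_1: "p > 1"
  using prime_p prime_gt_1_nat by blast

lemma prime_elem_p: "prime_elem (int p)"
  using prime_p by auto

lemma av_quotient:
  fixes m d :: int
  assumes "m \<noteq> 0" "d \<noteq> 0"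
  shows "av (of_int m / of_int d) =
           real p ^ multiplicity (int p) d / real p ^ multiplicity (int p) m"
  using assms p_gt_1
  by (simp add: padic_abs_rat_def padic_val_rat_quotient[OF prime_p] power_int_diff)

lemma av_0 [simp]: "av 0 = 0"
  by (simp add: padic_abs_rat_def)

lemma av_eq_0_iff [simp]: "av x = 0 \<longleftrightarrow> x = 0"
  using p_gt_1 by (auto simp: padic_abs_rat_def)

lemma av_nonneg [simp]: "av x \<ge> 0"
  by (auto simp: padic_abs_rat_def)

lemma av_pos_iff [simp]: "av x > 0 \<longleftrightarrow> x \<noteq> 0"
  using av_nonneg[of x] av_eq_0_iff[of x] by linarith

lemma rat_quotient_cases:
  fixes x :: rat
  obtains m d :: int where "x = of_int m / of_int d" "d \<noteq> 0" "coprime m d"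
  using quotient_of_div quotient_of_denom_pos quotient_of_coprime
  by (metis less_irrefl surj_pair)

lemma av_mult [simp]: "av (x * y) = av x * av y"
proof (cases "x = 0 \<or> y = 0")
  case False
  obtain a b where x: "x = of_int a / of_int b" "b \<noteq> 0"
    by (rule rat_quotient_cases)
  obtain c d where y: "y = of_int c / of_int d" "d \<noteq> 0"
    by (rule rat_quotient_cases)
  have nz: "a \<noteq> 0" "c \<noteq> 0"
    using False x y by auto
  have "x * y = of_int (a * c) / of_int (b * d)"
    by (simp add: x y)
  then have "av (x * y) = real p ^ multiplicity (int p) (b * d) / real p ^ multiplicity (int p) (a * c)"
    using nz x y av_quotient[of "a * c" "b * d"] by simp
  also have "\<dots> = av x * av y"
    using nz x y prime_elem_p
    by (simp add: av_quotient prime_elem_multiplicity_mult_distrib power_add)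
  finally show ?thesis .
qed auto

lemma av_1 [simp]: "av 1 = 1"
  using av_quotient[of 1 1] by simp

lemma av_minus [simp]: "av (- x) = av x"
proof -
  have "av (-1) = 1"
    using av_quotient[of "-1" 1] by simp
  then show ?thesis
    using av_mult[of "-1" x] by simp
qed

lemma av_diff_commute: "av (x - y) = av (y - x)"
  using av_minus[of "x - y"] by simp

lemma av_inverse [simp]: "av (inverse x) = inverse (av x)"
  using av_mult[of x "inverse x"] by (cases "x = 0") (auto simp: field_simps)

lemma av_divide [simp]: "av (x / y) = av x / av y"
  by (simp add: divide_inverse)

lemma av_power [simp]: "av (x ^ n) = av x ^ n"
  by (induction n) auto

lemma av_of_int: "m \<noteq> 0 \<Longrightarrow> av (of_int m) = 1 / real p ^ multiplicity (int p) m"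
  using av_quotient[of m 1] by simp

lemma av_of_int_le_1 [simp]: "av (of_int m) \<le> 1"
  using p_gt_1 by (cases "m = 0") (auto simp: av_of_int)

lemma av_p: "av (of_nat p) = 1 / real p"
  using av_of_int[of "int p"] p_gt_1 prime_elem_p by simp

lemma av_of_int_eq_1: "\<not> int p dvd m \<Longrightarrow> av (of_int m) = 1"
  by (cases "m = 0") (auto simp: av_of_int not_dvd_imp_multiplicity_0)

lemma av_le_1_cases:
  assumes "av x \<le> 1"
  obtains m d :: int where "x = of_int m / of_int d" "\<not> int p dvd d"
proof -
  obtain m d where x: "x = of_int m / of_int d" "d \<noteq> 0" "coprime m d"
    by (rule rat_quotient_cases)
  have "\<not> int p dvd d"
  proof
    assume d: "int p dvd d"
    then have m: "\<not> int p dvd m"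
      using x(3) prime_elem_p by (meson coprime_common_divisor prime_elem_not_unit)
    then have "m \<noteq> 0"
      by auto
    then have "av x = real p ^ multiplicity (int p) d"
      using x m av_quotient[of m d] by (simp add: not_dvd_imp_multiplicity_0 del: av_divide)
    moreover have "multiplicity (int p) d > 0"
      using d x(2) prime_elem_p by (subst prime_multiplicity_gt_zero_iff) auto
    ultimately have "av x > 1"
      using p_gt_1 by (simp add: one_less_power)
    then show False
      using assms by simp
  qed
  with x that show ?thesis
    by blast
qed

lemma av_one_plus_le: 
  assumes "av x \<le> 1"
  shows "av (1 + x) \<le> 1"
proof -
  obtain m d where x: "x = of_int m / of_int d" "\<not> int p dvd d"
    using assms by (rule av_le_1_cases)
  have "d \<noteq> 0"
    using x(2) by auto
  then have "1 + x = of_int (m + d) / of_int d"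
    using x(1) by (simp add: field_simps)
  then show ?thesis
    using x(2) by (simp add: av_of_int_eq_1 del: of_int_add)
qed

text \<open>The integrality statement \<open>av_one_plus_le\<close> is the ultrametric inequality scaled so that the larger
summand is 1; multiplicativity undoes the scaling.\<close>

lemma av_add_le_max: "av (x + y) \<le> max (av x) (av y)"
proof -
  have *: "av (x + y) \<le> max (av x) (av y)" if le: "av x \<le> av y" for x y
  proof (cases "y = 0")
    case False
    have "x + y = (1 + x / y) * y"
      using False by (simp add: field_simps)
    moreover have "av (1 + x / y) \<le> 1"
      using le False by (intro av_one_plus_le) simp
    ultimately have "av (x + y) \<le> 1 * av y"
      using mult_right_mono by fastforce
    then show ?thesis
      using le by simp
  qed (use le in auto)
  show ?thesis
    using *[of x y] *[of y x] by (cases "av x \<le> av y") (auto simp: max.commute add.commute)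
qed

lemma av_diff_le_max: "av (x - y) \<le> max (av x) (av y)"
  using av_add_le_max[of x "- y"] by simp

lemma av_triangle: "av (x + y) \<le> av x + av y"
  using av_add_le_max[of x y] av_nonneg[of x] av_nonneg[of y] by linarith

lemma av_eq_of_close:
  assumes "av (x - y) < av y"
  shows "av x = av y"
  using av_add_le_max[of "x - y" y] av_diff_le_max[of x "x - y"] assms
  by (simp add: max_def split: if_splits)

text \<open>For an integer, the p-adic and the usual absolute value multiply to the absolute value of its
part prime to \<open>p\<close>, a positive integer. All lower bounds for sizes of remainders come from here.\<close>

lemma av_product_ge_1:
  assumes "m \<noteq> 0"
  shows "av (of_int m) * of_int \<bar>m\<bar> \<ge> 1"
proof -
  have "int p ^ multiplicity (int p) m \<le> \<bar>m\<bar>"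
    using dvd_imp_le_int[OF assms multiplicity_dvd[of "int p" m]] by (simp add: power_abs)
  then have "real_of_int (int p ^ multiplicity (int p) m) \<le> of_int \<bar>m\<bar>"
    by (simp only: of_int_le_iff)
  then show ?thesis
    using assms p_gt_1 by (simp add: av_of_int field_simps)
qed

section \<open>The field of p-adic numbers as classes of Cauchy sequences\<close>

abbreviation padic_seq :: "(nat \<Rightarrow> rat) \<Rightarrow> bool" where
  "padic_seq f \<equiv> f \<in> padic_Cauchy p"

abbreviation null_seq :: "(nat \<Rightarrow> rat) \<Rightarrow> bool" where
  "null_seq f \<equiv> f \<in> padic_null p"

lemma null_seq_iff: "null_seq f \<longleftrightarrow> (\<forall>e>0. \<forall>\<^sub>F n in sequentially. av (f n) < e)"
  by (simp add: padic_null_def tendsto_iff dist_real_def)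

lemma null_seqD: "null_seq f \<Longrightarrow> e > 0 \<Longrightarrow> \<forall>\<^sub>F n in sequentially. av (f n) < e"
  by (simp add: null_seq_iff)

lemma padic_seqD: 
  assumes "padic_seq f" "e > 0" 
  obtains K where "\<And>m n. m \<ge> K \<Longrightarrow> n \<ge> K \<Longrightarrow> av (f m - f n) < e"
  using assms unfolding padic_Cauchy_def by blast

lemma padic_seqI: 
  assumes "\<And>e. e > 0 \<Longrightarrow> \<exists>K. \<forall>m\<ge>K. \<forall>n\<ge>K. av (f m - f n) < e"
  shows "padic_seq f"
  using assms unfolding padic_Cauchy_def by blast

lemma padic_seq_eventually_bounded:
  assumes "padic_seq f"
  obtains B where "B > 0" "\<forall>\<^sub>F n in sequentially. av (f n) \<le> B"
proof -
  obtain K where K: "\<And>m n. m \<ge> K \<Longrightarrow> n \<ge> K \<Longrightarrow> av (f m - f n) < 1"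
    using assms zero_less_one by (rule padic_seqD) blast
  have "av (f n) \<le> av (f K) + 1" if "n \<ge> K" for n
    using K[OF that, of K] av_triangle[of "f n - f K" "f K"] by simp
  then have "\<forall>\<^sub>F n in sequentially. av (f n) \<le> av (f K) + 1"
    unfolding eventually_sequentially by blast
  moreover have "av (f K) + 1 > 0"
    using av_nonneg[of "f K"] by linarith
  ultimately show ?thesis
    using that by blast
qed

lemma padic_seq_const [simp]: "padic_seq (\<lambda>_. x)"
  by (rule padic_seqI) simp

lemma null_seq_0 [simp]: "null_seq (\<lambda>_. 0)"
  by (simp add: null_seq_iff)

lemma null_seq_const_iff [simp]: "null_seq (\<lambda>_. x) \<longleftrightarrow> x = 0"
  by (auto simp: padic_null_def LIMSEQ_const_iff)

lemma padic_seq_minus [simp]: "padic_seq f \<Longrightarrow> padic_seq (\<lambda>n. - f n)"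
  unfolding padic_Cauchy_def by (simp add: av_diff_commute)

lemma padic_seq_add [simp]:
  assumes "padic_seq f" "padic_seq g"
  shows "padic_seq (\<lambda>n. f n + g n)"
proof (rule padic_seqI)
  fix e :: real
  assume e: "e > 0"
  obtain K where K: "\<And>m n. m \<ge> K \<Longrightarrow> n \<ge> K \<Longrightarrow> av (f m - f n) < e"
    using assms(1) e by (rule padic_seqD) blast
  obtain L where L: "\<And>m n. m \<ge> L \<Longrightarrow> n \<ge> L \<Longrightarrow> av (g m - g n) < e"
    using assms(2) e by (rule padic_seqD) blast
  have "av ((f m + g m) - (f n + g n)) < e" if "m \<ge> max K L" "n \<ge> max K L" for m n
    using that K[of m n] L[of m n] av_add_le_max[of "f m - f n" "g m - g n"]
    by (simp add: algebra_simps)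
  then show "\<exists>K. \<forall>m\<ge>K. \<forall>n\<ge>K. av ((f m + g m) - (f n + g n)) < e"
    by blast
qed

lemma padic_seq_mult [simp]:
  assumes "padic_seq f" "padic_seq g"
  shows "padic_seq (\<lambda>n. f n * g n)"
proof (rule padic_seqI)
  fix e :: real
  assume e: "e > 0"
  obtain B where B: "B > 0" "\<forall>\<^sub>F n in sequentially. av (f n) \<le> B"
    using assms(1) by (rule padic_seq_eventually_bounded)
  obtain C where C: "C > 0" "\<forall>\<^sub>F n in sequentially. av (g n) \<le> C"
    using assms(2) by (rule padic_seq_eventually_bounded)
  obtain K where K: "\<And>m n. m \<ge> K \<Longrightarrow> n \<ge> K \<Longrightarrow> av (f m - f n) < e / C"
    using assms(1) divide_pos_pos[OF e C(1)] by (rule padic_seqD) blast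
  obtain L where L: "\<And>m n. m \<ge> L \<Longrightarrow> n \<ge> L \<Longrightarrow> av (g m - g n) < e / B"
    using assms(2) divide_pos_pos[OF e B(1)] by (rule padic_seqD) blast
  obtain M where M: "\<And>n. n \<ge> M \<Longrightarrow> av (f n) \<le> B \<and> av (g n) \<le> C"
    using eventually_conj[OF B(2) C(2)] unfolding eventually_sequentially by blast
  have "av (f m * g m - f n * g n) < e"
    if "m \<ge> max M (max K L)" "n \<ge> max M (max K L)" for m n
  proof -
    have *: "av (f m) \<le> B" "av (g n) \<le> C" "av (f m - f n) < e / C" "av (g m - g n) < e / B"
      using that M[of m] M[of n] K[of m n] L[of m n] by auto
    have "av (f m) * av (g m - g n) \<le> B * av (g m - g n)"
      using * by (intro mult_right_mono) auto
    also have "\<dots> < B * (e / B)"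
      using * B(1) by (intro mult_strict_left_mono) auto
    finally have 1: "av (f m * (g m - g n)) < e"
      using B(1) by simp
    have "av (f m - f n) * av (g n) \<le> av (f m - f n) * C"
      using * by (intro mult_left_mono) auto
    also have "\<dots> < e / C * C"
      using * C(1) by (intro mult_strict_right_mono) auto
    finally have 2: "av ((f m - f n) * g n) < e"
      using C(1) by simp
    have "f m * g m - f n * g n = f m * (g m - g n) + (f m - f n) * g n"
      by (simp add: algebra_simps)
    then show ?thesis
      using 1 2 av_add_le_max[of "f m * (g m - g n)" "(f m - f n) * g n"] by simp
  qed
  then show "\<exists>K. \<forall>m\<ge>K. \<forall>n\<ge>K. av (f m * g m - f n * g n) < e"
    by blast
qed

lemma padic_seq_diff [simp]:
  assumes "padic_seq f" "padic_seq g"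
  shows "padic_seq (\<lambda>n. f n - g n)"
  using padic_seq_add[OF assms(1) padic_seq_minus[OF assms(2)]] by simp

lemma null_seq_minus [simp]: "null_seq f \<Longrightarrow> null_seq (\<lambda>n. - f n)"
  by (simp add: null_seq_iff)

lemma null_seq_add [simp]:
  assumes "null_seq f" "null_seq g"
  shows "null_seq (\<lambda>n. f n + g n)"
  unfolding null_seq_iff
proof (intro allI impI)
  fix e :: real
  assume "e > 0"
  then have "\<forall>\<^sub>F n in sequentially. av (f n) < e \<and> av (g n) < e"
    using assms by (intro eventually_conj null_seqD)
  then show "\<forall>\<^sub>F n in sequentially. av (f n + g n) < e"
    by eventually_elim (use av_add_le_max in \<open>meson max_less_iff_conj order_le_less_trans\<close>)
qed

lemma null_seq_diff [simp]: 
  assumes "null_seq f" "null_seq g"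
  shows "null_seq (\<lambda>n. f n - g n)"
  using null_seq_add[OF assms(1) null_seq_minus[OF assms(2)]] by simp

lemma null_seq_mult_left:
  assumes "null_seq f" "padic_seq g"
  shows "null_seq (\<lambda>n. g n * f n)"
  unfolding null_seq_iff
proof (intro allI impI)
  fix e :: real
  assume e: "e > 0"
  obtain B where B: "B > 0" "\<forall>\<^sub>F n in sequentially. av (g n) \<le> B"
    using assms(2) by (rule padic_seq_eventually_bounded)
  have "\<forall>\<^sub>F n in sequentially. av (f n) < e / B"
    using assms(1) B(1) e by (intro null_seqD) auto
  with B(2) show "\<forall>\<^sub>F n in sequentially. av (g n * f n) < e"
  proof eventually_elim
    case (elim n)
    have "av (g n) * av (f n) \<le> B * av (f n)"
      using elim by (intro mult_right_mono) auto
    also have "\<dots> < B * (e / B)"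
      using elim B(1) by (intro mult_strict_left_mono) auto
    finally show ?case
      using B(1) by simp
  qed
qed

lemma null_seq_mult_right:
  "null_seq f \<Longrightarrow> padic_seq g \<Longrightarrow> null_seq (\<lambda>n. f n * g n)"
  using null_seq_mult_left[of f g] by (simp add: mult.commute)

lemma null_seq_imp_padic_seq:
  assumes "null_seq f"
  shows "padic_seq f"
proof (rule padic_seqI)
  fix e :: real
  assume "e > 0"
  then obtain K where K: "\<And>n. n \<ge> K \<Longrightarrow> av (f n) < e"
    using null_seqD[OF assms] unfolding eventually_sequentially by blast
  have "av (f m - f n) < e" if "m \<ge> K" "n \<ge> K" for m n
    using K[of m] K[of n] that av_diff_le_max[of "f m" "f n"] by simp
  then show "\<exists>K. \<forall>m\<ge>K. \<forall>n\<ge>K. av (f m - f n) < e"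
    by blast
qed

lemma cring_padic_Cauchy_ring: "cring (padic_Cauchy_ring p)"
proof (intro cringI abelian_groupI comm_monoidI)
  fix x assume "x \<in> carrier (padic_Cauchy_ring p)"
  then show "\<exists>y\<in>carrier (padic_Cauchy_ring p).
      y \<oplus>\<^bsub>padic_Cauchy_ring p\<^esub> x = \<zero>\<^bsub>padic_Cauchy_ring p\<^esub>"
    by (intro bexI[of _ "\<lambda>n. - x n"]) (auto simp: padic_Cauchy_ring_def)
qed (auto simp: padic_Cauchy_ring_def algebra_simps)

lemma minus_padic_Cauchy_ring:
  assumes "padic_seq f"
  shows "\<ominus>\<^bsub>padic_Cauchy_ring p\<^esub> f = (\<lambda>n. - f n)"
proof -
  interpret cring "padic_Cauchy_ring p"
    by (rule cring_padic_Cauchy_ring)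
  show ?thesis
    by (rule minus_equality) (use assms in \<open>auto simp: padic_Cauchy_ring_def\<close>)
qed

lemma ideal_padic_null: "ideal (padic_null p) (padic_Cauchy_ring p)"
proof -
  interpret cring "padic_Cauchy_ring p"
    by (rule cring_padic_Cauchy_ring)
  show ?thesis
  proof (rule idealI)
    show "ring (padic_Cauchy_ring p)"
      by (rule ring_axioms)
    show "subgroup (padic_null p) (add_monoid (padic_Cauchy_ring p))"
    proof (rule add.subgroupI)
      show "padic_null p \<subseteq> carrier (padic_Cauchy_ring p)"
        by (auto simp: padic_Cauchy_ring_def null_seq_imp_padic_seq)
      show "padic_null p \<noteq> {}"
        using null_seq_0 by blast
      show "\<ominus>\<^bsub>padic_Cauchy_ring p\<^esub> f \<in> padic_null p" if "f \<in> padic_null p" for f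
        using that by (simp add: minus_padic_Cauchy_ring null_seq_imp_padic_seq)
    qed (auto simp: padic_Cauchy_ring_def)
  qed (auto simp: padic_Cauchy_ring_def null_seq_mult_left null_seq_mult_right)
qed

lemma cring_Qp: "cring (Qp p)"
  unfolding Qp_def by (rule ideal.quotient_is_cring[OF ideal_padic_null cring_padic_Cauchy_ring])

text \<open>The quotient map onto \<open>Qp p\<close>. Every operation on classes is computed on representing sequences,
so that identities over \<open>Qp p\<close> reduce to identities between rational numbers.\<close>

definition cls :: "(nat \<Rightarrow> rat) \<Rightarrow> padic" where
  "cls f = padic_null p +>\<^bsub>padic_Cauchy_ring p\<^esub> f"

lemma in_cls_iff: "g \<in> cls f \<longleftrightarrow> null_seq (\<lambda>n. g n - f n)"
proof
  assume "g \<in> cls f"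
  then obtain h where "null_seq h" "g = (\<lambda>n. h n + f n)"
    by (auto simp: cls_def a_r_coset_def' padic_Cauchy_ring_def)
  then show "null_seq (\<lambda>n. g n - f n)"
    by simp
next
  assume "null_seq (\<lambda>n. g n - f n)"
  then have "(\<lambda>n. (g n - f n) + f n) \<in> cls f"
    by (auto simp: cls_def a_r_coset_def' padic_Cauchy_ring_def intro!: bexI[of _ "\<lambda>n. g n - f n"])
  then show "g \<in> cls f"
    by simp
qed

lemma cls_eq_iff: "cls f = cls g \<longleftrightarrow> null_seq (\<lambda>n. f n - g n)"
proof
  assume "cls f = cls g"
  moreover have "f \<in> cls f"
    by (simp add: in_cls_iff)
  ultimately show "null_seq (\<lambda>n. f n - g n)"
    by (simp add: in_cls_iff)
next
  assume *: "null_seq (\<lambda>n. f n - g n)"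
  show "cls f = cls g"
  proof (intro Set.set_eqI iffI)
    fix h
    assume "h \<in> cls f"
    then show "h \<in> cls g"
      using null_seq_add[of "\<lambda>n. h n - f n" "\<lambda>n. f n - g n"] * by (simp add: in_cls_iff)
  next
    fix h
    assume "h \<in> cls g"
    then show "h \<in> cls f"
      using null_seq_diff[of "\<lambda>n. h n - g n" "\<lambda>n. f n - g n"] * by (simp add: in_cls_iff)
  qed
qed

lemma cls_ring_hom: "cls \<in> ring_hom (padic_Cauchy_ring p) (Qp p)"
proof -
  have "cls = (+>\<^bsub>padic_Cauchy_ring p\<^esub>) (padic_null p)"
    by (auto simp: cls_def)
  then show ?thesis
    using ideal.rcos_ring_hom[OF ideal_padic_null] by (simp add: Qp_def)
qed

lemma carrier_Qp: "carrier (Qp p) = cls ` padic_Cauchy p"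
  by (auto simp: Qp_def FactRing_def A_RCOSETS_def' cls_def padic_Cauchy_ring_def)

lemma cls_in_carrier [simp]: "padic_seq f \<Longrightarrow> cls f \<in> carrier (Qp p)"
  by (simp add: carrier_Qp)

lemma cls_add: "padic_seq f \<Longrightarrow> padic_seq g \<Longrightarrow> cls f \<oplus>\<^bsub>Qp p\<^esub> cls g = cls (\<lambda>n. f n + g n)"
  using ring_hom_add[OF cls_ring_hom, of f g] by (simp add: padic_Cauchy_ring_def)

lemma cls_mult: "padic_seq f \<Longrightarrow> padic_seq g \<Longrightarrow> cls f \<otimes>\<^bsub>Qp p\<^esub> cls g = cls (\<lambda>n. f n * g n)"
  using ring_hom_mult[OF cls_ring_hom, of f g] by (simp add: padic_Cauchy_ring_def)

lemma one_Qp: "\<one>\<^bsub>Qp p\<^esub> = cls (\<lambda>_. 1)"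
  using ring_hom_one[OF cls_ring_hom] by (simp add: padic_Cauchy_ring_def)

lemma zero_Qp: "\<zero>\<^bsub>Qp p\<^esub> = cls (\<lambda>_. 0)"
  using ring_hom_zero[OF cls_ring_hom cring.axioms(1)[OF cring_padic_Cauchy_ring] cring.axioms(1)[OF cring_Qp]]
  by (simp add: padic_Cauchy_ring_def)

lemma cls_diff:
  assumes "padic_seq f" "padic_seq g"
  shows "cls f \<ominus>\<^bsub>Qp p\<^esub> cls g = cls (\<lambda>n. f n - g n)"
proof -
  interpret cring "Qp p"
    by (rule cring_Qp)
  have "\<ominus>\<^bsub>Qp p\<^esub> cls g = cls (\<lambda>n. - g n)"
    by (rule minus_equality) (use assms in \<open>auto simp: cls_add zero_Qp\<close>)
  then show ?thesis
    using assms by (simp add: a_minus_def cls_add)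
qed

lemma padic_of_rat_cls: "padic_of_rat p x = cls (\<lambda>_. x)"
  by (simp add: padic_of_rat_def cls_def)

lemma cls_eq_0_iff: "cls f = \<zero>\<^bsub>Qp p\<^esub> \<longleftrightarrow> null_seq f"
  by (simp add: zero_Qp cls_eq_iff)

lemma av_eq_imp_val_eq:
  assumes "av x = av y" "y \<noteq> 0"
  shows "x \<noteq> 0 \<and> padic_val_rat p x = padic_val_rat p y"
proof -
  have "x \<noteq> 0"
    using assms av_eq_0_iff by metis
  then have "real p powi (- padic_val_rat p x) = real p powi (- padic_val_rat p y)"
    using assms by (simp add: padic_abs_rat_def)
  then show ?thesis
    using \<open>x \<noteq> 0\<close> p_gt_1 power_int_strict_increasing[of _ _ "real p"]
    by (metis less_irrefl linorder_neqE_linordered_idom neg_equal_iff_equal of_nat_1 of_nat_less_iff)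
qed

text \<open>A Cauchy sequence that is not null stays away from 0 infinitely often, hence, by the ultrametric
inequality, has an eventually constant absolute value, which a null sequence added to it cannot
change. So the definite description in \<open>padic_val\<close> is meaningful and can be read off any
representative.\<close>

lemma padic_val_cls:
  assumes f: "padic_seq f" and nn: "\<not> null_seq f"
  shows "\<forall>\<^sub>F n in sequentially. f n \<noteq> 0 \<and> padic_val_rat p (f n) = padic_val p (cls f)"
proof -
  obtain e where e: "e > 0" "\<exists>\<^sub>F n in sequentially. av (f n) \<ge> e"
    using nn unfolding null_seq_iff not_eventually not_less by (auto simp: not_eventually not_less)
  obtain K where K: "\<And>m n. m \<ge> K \<Longrightarrow> n \<ge> K \<Longrightarrow> av (f m - f n) < e"
    using f e(1) by (rule padic_seqD) blast
  obtain m where m: "m \<ge> K" "av (f m) \<ge> e"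
    using e(2) by (auto simp: frequently_sequentially)
  have f_eq: "av (f n) = av (f m)" if "n \<ge> K" for n
    using K[OF that m(1)] m(2) by (intro av_eq_of_close) simp
  have fm: "f m \<noteq> 0"
    using m e(1) by auto
  define k where "k = padic_val_rat p (f m)"
  have k: "\<forall>\<^sub>F n in sequentially. g n \<noteq> 0 \<and> padic_val_rat p (g n) = k" if g: "g \<in> cls f" for g
  proof -
    have "\<forall>\<^sub>F n in sequentially. av (g n - f n) < e"
      using g e(1) null_seqD by (auto simp: in_cls_iff)
    moreover have "\<forall>\<^sub>F n in sequentially. n \<ge> K"
      by (rule eventually_ge_at_top)
    ultimately show ?thesis
    proof eventually_elim
      case (elim n)
      then have "av (g n) = av (f n)"
        using f_eq[of n] m(2) by (intro av_eq_of_close) simp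
      then show ?case
        unfolding k_def using f_eq[of n] elim fm by (intro av_eq_imp_val_eq) auto
    qed
  qed
  have ff: "f \<in> cls f"
    by (simp add: in_cls_iff)
  have "padic_val p (cls f) = k"
    unfolding padic_val_def
  proof (rule the_equality)
    fix l
    assume "\<forall>g\<in>cls f. \<forall>\<^sub>F n in sequentially. g n \<noteq> 0 \<and> padic_val_rat p (g n) = l"
    with ff have "\<forall>\<^sub>F n in sequentially. f n \<noteq> 0 \<and> padic_val_rat p (f n) = l"
      by blast
    with k[OF ff] have "\<forall>\<^sub>F n in sequentially. l = k"
      by eventually_elim simp
    then show "l = k"
      by simp
  qed (use k in blast)
  then show ?thesis
    using k[OF ff] by simp
qed

lemma padic_val_of_rat: "x \<noteq> 0 \<Longrightarrow> padic_val p (cls (\<lambda>_. x)) = padic_val_rat p x"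
  using padic_val_cls[of "\<lambda>_. x"] by simp

lemma Zp_cases:
  assumes "x \<in> Zp p"
  obtains f where "padic_seq f" "x = cls f" "\<forall>\<^sub>F n in sequentially. av (f n) \<le> 1"
proof -
  obtain f where f: "padic_seq f" "x = cls f"
    using assms by (auto simp: Zp_def carrier_Qp)
  have "\<forall>\<^sub>F n in sequentially. av (f n) \<le> 1"
  proof (cases "null_seq f")
    case True
    then show ?thesis
      using null_seqD[of f 1] by (auto elim: eventually_mono)
  next
    case False
    then have "padic_val p x \<ge> 0"
      using assms f by (auto simp: Zp_def cls_eq_0_iff)
    with f(2) have "padic_val p (cls f) \<ge> 0"
      by simp
    from padic_val_cls[OF f(1) False] show ?thesis
    proof eventually_elim
      case (elim n)
      with \<open>padic_val p (cls f) \<ge> 0\<close> show ?case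
        using p_gt_1 by (auto simp: padic_abs_rat_def power_int_le_one power_int_minus field_simps)
    qed
  qed
  then show ?thesis
    using f that by blast
qed

end

section \<open>Quaternions in coordinates\<close>

lemma quat_eq_iff:
  "x = y \<longleftrightarrow> q_one x = q_one y \<and> q_i x = q_i y \<and> q_j x = q_j y \<and> q_k x = q_k y"
  by (cases x; cases y) auto

text \<open>The additive structure is an instance of the library classes, whereas the multiplication
\<open>qmul a b\<close> depends on the structure constants and remains a function.\<close>

instantiation quat :: (ab_group_add) ab_group_add
begin

definition zero_quat :: "'a quat" where
  "zero_quat = Quat 0 0 0 0"

definition plus_quat :: "'a quat \<Rightarrow> 'a quat \<Rightarrow> 'a quat" where
  "plus_quat x y = Quat (q_one x + q_one y) (q_i x + q_i y) (q_j x + q_j y) (q_k x + q_k y)"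

definition uminus_quat :: "'a quat \<Rightarrow> 'a quat" where
  "uminus_quat x = Quat (- q_one x) (- q_i x) (- q_j x) (- q_k x)"

definition minus_quat :: "'a quat \<Rightarrow> 'a quat \<Rightarrow> 'a quat" where
  "minus_quat x y = Quat (q_one x - q_one y) (q_i x - q_i y) (q_j x - q_j y) (q_k x - q_k y)"

instance
  by standard
    (auto simp: quat_eq_iff zero_quat_def plus_quat_def uminus_quat_def minus_quat_def)

end

lemma quat_zero_sel [simp]:
  "q_one 0 = 0" "q_i 0 = 0" "q_j 0 = 0" "q_k 0 = 0"
  by (simp_all add: zero_quat_def)

lemma quat_plus_sel [simp]:
  "q_one (x + y) = q_one x + q_one y" "q_i (x + y) = q_i x + q_i y"
  "q_j (x + y) = q_j x + q_j y" "q_k (x + y) = q_k x + q_k y"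
  by (simp_all add: plus_quat_def)

lemma quat_minus_sel [simp]:
  "q_one (x - y) = q_one x - q_one y" "q_i (x - y) = q_i x - q_i y"
  "q_j (x - y) = q_j x - q_j y" "q_k (x - y) = q_k x - q_k y"
  by (simp_all add: minus_quat_def)

lemma quat_uminus_sel [simp]:
  "q_one (- x) = - q_one x" "q_i (- x) = - q_i x"
  "q_j (- x) = - q_j x" "q_k (- x) = - q_k x"
  by (simp_all add: uminus_quat_def)

lemma quat_sum_sel:
  "q_one (sum f A) = (\<Sum>x\<in>A. q_one (f x))" "q_i (sum f A) = (\<Sum>x\<in>A. q_i (f x))"
  "q_j (sum f A) = (\<Sum>x\<in>A. q_j (f x))" "q_k (sum f A) = (\<Sum>x\<in>A. q_k (f x))"
  by (induction A rule: infinite_finite_induct; simp)+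

definition qof :: "'k::zero \<Rightarrow> 'k quat" where
  "qof c = Quat c 0 0 0"

definition qscale :: "'k::times \<Rightarrow> 'k quat \<Rightarrow> 'k quat" where
  "qscale c x = Quat (c * q_one x) (c * q_i x) (c * q_j x) (c * q_k x)"

definition qconj :: "'k::uminus quat \<Rightarrow> 'k quat" where
  "qconj x = Quat (q_one x) (- q_i x) (- q_j x) (- q_k x)"

definition qmul :: "'k::comm_ring_1 \<Rightarrow> 'k \<Rightarrow> 'k quat \<Rightarrow> 'k quat \<Rightarrow> 'k quat" where
  "qmul a b x y = Quat
     (q_one x * q_one y + a * (q_i x * q_i y) + b * (q_j x * q_j y) - a * b * (q_k x * q_k y))
     (q_one x * q_i y + q_i x * q_one y + b * (q_k x * q_j y) - b * (q_j x * q_k y))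
     (q_one x * q_j y + q_j x * q_one y + a * (q_i x * q_k y) - a * (q_k x * q_i y))
     (q_one x * q_k y + q_k x * q_one y + q_i x * q_j y - q_j x * q_i y)"

definition qnrd :: "'k::comm_ring_1 \<Rightarrow> 'k \<Rightarrow> 'k quat \<Rightarrow> 'k" where
  "qnrd a b x = q_one x * q_one x - a * (q_i x * q_i x) - b * (q_j x * q_j x)
     + a * b * (q_k x * q_k x)"

lemma qof_sel [simp]: "q_one (qof c) = c" "q_i (qof c) = 0" "q_j (qof c) = 0" "q_k (qof c) = 0"
  by (simp_all add: qof_def)

lemma qscale_sel [simp]: "q_one (qscale c x) = c * q_one x" "q_i (qscale c x) = c * q_i x"
  "q_j (qscale c x) = c * q_j x" "q_k (qscale c x) = c * q_k x"
  by (simp_all add: qscale_def)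

lemma qconj_sel [simp]: "q_one (qconj x) = q_one x" "q_i (qconj x) = - q_i x"
  "q_j (qconj x) = - q_j x" "q_k (qconj x) = - q_k x"
  by (simp_all add: qconj_def)

lemma qmul_assoc: "qmul a b (qmul a b x y) z = qmul a b x (qmul a b y z)"
  by (simp add: quat_eq_iff qmul_def algebra_simps)

lemma qmul_diff_left: "qmul a b (x - y) z = qmul a b x z - qmul a b y z"
  by (simp add: quat_eq_iff qmul_def algebra_simps)

lemma qmul_add_left: "qmul a b (x + y) z = qmul a b x z + qmul a b y z"
  by (simp add: quat_eq_iff qmul_def algebra_simps)

lemma qmul_qof_left [simp]: "qmul a b (qof c) x = qscale c x"
  by (simp add: quat_eq_iff qmul_def)

lemma qmul_qof_right [simp]: "qmul a b x (qof c) = qscale c x"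
  by (simp add: quat_eq_iff qmul_def mult.commute)

lemma qscale_1 [simp]: "qscale (1 :: 'k :: monoid_mult) x = x"
  by (simp add: quat_eq_iff)

lemma qscale_qscale: "qscale c (qscale d x) = qscale (c * d :: 'k :: comm_ring_1) x"
  by (simp add: quat_eq_iff mult.assoc)

lemma qscale_add_left: "qscale (c + d :: 'k :: comm_ring_1) x = qscale c x + qscale d x"
  by (simp add: quat_eq_iff distrib_right)

lemma qscale_add_right: "qscale (c :: 'k :: comm_ring_1) (x + y) = qscale c x + qscale c y"
  by (simp add: quat_eq_iff distrib_left)

lemma qscale_diff_right: "qscale (c :: 'k :: comm_ring_1) (x - y) = qscale c x - qscale c y"
  by (simp add: quat_eq_iff right_diff_distrib)

lemma qmul_qscale_left: "qmul a b (qscale c x) y = qscale c (qmul a b x y)"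
  by (simp add: quat_eq_iff qmul_def algebra_simps)

lemma qmul_qscale_right: "qmul a b x (qscale c y) = qscale c (qmul a b x y)"
  by (simp add: quat_eq_iff qmul_def algebra_simps)

lemma qmul_qconj: "qmul a b x (qconj x) = qof (qnrd a b x)"
  by (simp add: quat_eq_iff qmul_def qnrd_def algebra_simps)

lemma qconj_qmul: "qmul a b (qconj x) x = qof (qnrd a b x)"
  by (simp add: quat_eq_iff qmul_def qnrd_def algebra_simps)

lemma qnrd_qmul: "qnrd a b (qmul a b x y) = qnrd a b x * qnrd a b y"
  by (simp add: qmul_def qnrd_def algebra_simps)

lemma qnrd_qof [simp]: "qnrd a b (qof c) = c * c"
  by (simp add: qnrd_def)

lemma qnrd_0 [simp]: "qnrd a b 0 = 0"
  by (simp add: qnrd_def)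

lemma qnrd_uminus [simp]: "qnrd a b (- x) = qnrd a b x"
  by (simp add: qnrd_def)

lemma qnrd_qscale: "qnrd a b (qscale c x) = c\<^sup>2 * qnrd a b x"
  by (simp add: qnrd_def algebra_simps power2_eq_square)

lemma qnrd_qof_diff: "qnrd a b (x - qof t) = qnrd a b x - 2 * q_one x * t + t\<^sup>2"
  by (simp add: qnrd_def algebra_simps power2_eq_square)

lemma minus_ring_of_type_algebra:
  fixes x y :: "'k::comm_ring_1"
  shows "x \<ominus>\<^bsub>ring_of_type_algebra\<^esub> y = x - y"
proof -
  interpret cring "ring_of_type_algebra :: 'k ring"
    by (rule cring_from_type_algebra)
  have "\<ominus>\<^bsub>ring_of_type_algebra\<^esub> y = - y"
    by (rule minus_equality) (auto simp: ring_of_type_algebra_def)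
  then show ?thesis
    by (simp add: a_minus_def) (simp add: ring_of_type_algebra_def)
qed

lemma ring_of_type_algebra_simps:
  "carrier ring_of_type_algebra = UNIV"
  "x \<oplus>\<^bsub>ring_of_type_algebra\<^esub> y = x + y"
  "x \<otimes>\<^bsub>ring_of_type_algebra\<^esub> y = x * y"
  "\<zero>\<^bsub>ring_of_type_algebra\<^esub> = 0"
  "\<one>\<^bsub>ring_of_type_algebra\<^esub> = 1"
  by (simp_all add: ring_of_type_algebra_def)

lemma quat_alg_type_simps:
  fixes a b c :: "'k::comm_ring_1"
  shows "carrier (quat_alg ring_of_type_algebra a b) = UNIV"
    and "x \<otimes>\<^bsub>quat_alg ring_of_type_algebra a b\<^esub> y = qmul a b x y"
    and "x \<oplus>\<^bsub>quat_alg ring_of_type_algebra a b\<^esub> y = x + y"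
    and "\<one>\<^bsub>quat_alg ring_of_type_algebra a b\<^esub> = qof 1"
    and "\<zero>\<^bsub>quat_alg ring_of_type_algebra a b\<^esub> = 0"
    and "c \<odot>\<^bsub>quat_alg ring_of_type_algebra a b\<^esub> x = qscale c x"
  by (cases x; cases y; simp add: quat_alg_def ring_of_type_algebra_simps
      minus_ring_of_type_algebra qmul_def plus_quat_def zero_quat_def qof_def qscale_def)+

lemmas BQ_simps = quat_alg_type_simps[of a b for a b :: rat, folded BQ_def]
lemmas Binf_simps =
  quat_alg_type_simps[of "of_rat a :: real" "of_rat b" for a b :: rat, folded Binf_def]

section \<open>Quaternions over the p-adic numbers\<close>

context padic_prime
begin

text \<open>In analogy with \<open>cls\<close>, p-adic quaternions are classes of coordinatewise Cauchy sequences of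
rational quaternions, and the operations of \<open>Bp a b p\<close> are computed term by term.\<close>

definition quat_seq :: "(nat \<Rightarrow> rat quat) \<Rightarrow> bool" where
  "quat_seq F \<longleftrightarrow> padic_seq (\<lambda>n. q_one (F n)) \<and> padic_seq (\<lambda>n. q_i (F n)) \<and>
     padic_seq (\<lambda>n. q_j (F n)) \<and> padic_seq (\<lambda>n. q_k (F n))"

definition qcls :: "(nat \<Rightarrow> rat quat) \<Rightarrow> padic quat" where
  "qcls F = Quat (cls (\<lambda>n. q_one (F n))) (cls (\<lambda>n. q_i (F n)))
                 (cls (\<lambda>n. q_j (F n))) (cls (\<lambda>n. q_k (F n)))"

lemma quat_seq_const [simp]: "quat_seq (\<lambda>_. x)"
  by (simp add: quat_seq_def)

lemma quat_seq_add [simp]: "quat_seq F \<Longrightarrow> quat_seq G \<Longrightarrow> quat_seq (\<lambda>n. F n + G n)"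
  by (simp add: quat_seq_def)

lemma quat_seq_diff [simp]: "quat_seq F \<Longrightarrow> quat_seq G \<Longrightarrow> quat_seq (\<lambda>n. F n - G n)"
  by (simp add: quat_seq_def)

lemma quat_seq_qmul [simp]: "quat_seq F \<Longrightarrow> quat_seq G \<Longrightarrow> quat_seq (\<lambda>n. qmul a b (F n) (G n))"
  by (simp add: quat_seq_def qmul_def)

lemma quat_seq_qscale [simp]: "padic_seq f \<Longrightarrow> quat_seq G \<Longrightarrow> quat_seq (\<lambda>n. qscale (f n) (G n))"
  by (simp add: quat_seq_def)

lemma quat_seq_qof [simp]: "padic_seq f \<Longrightarrow> quat_seq (\<lambda>n. qof (f n))"
  by (simp add: quat_seq_def)

lemma quat_seq_qconj [simp]: "quat_seq F \<Longrightarrow> quat_seq (\<lambda>n. qconj (F n))"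
  by (simp add: quat_seq_def)

lemma padic_seq_qnrd [simp]: "quat_seq F \<Longrightarrow> padic_seq (\<lambda>n. qnrd a b (F n))"
  by (simp add: quat_seq_def qnrd_def)

lemma carrier_Bp: "carrier (Bp a b p) = qcls ` Collect quat_seq"
proof (intro Set.set_eqI iffI)
  fix x assume "x \<in> carrier (Bp a b p)"
  then have "set_quat x \<subseteq> cls ` padic_Cauchy p"
    by (simp add: Bp_def quat_alg_def carrier_Qp)
  then obtain f g h k where
    "x = Quat (cls f) (cls g) (cls h) (cls k)" "padic_seq f" "padic_seq g" "padic_seq h" "padic_seq k"
    by (cases x) auto
  then show "x \<in> qcls ` Collect quat_seq"
    by (intro image_eqI[of _ _ "\<lambda>n. Quat (f n) (g n) (h n) (k n)"])
       (auto simp: qcls_def quat_seq_def)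
qed (auto simp: Bp_def quat_alg_def qcls_def quat_seq_def)

lemma qcls_in_carrier [simp]: "quat_seq F \<Longrightarrow> qcls F \<in> carrier (Bp a b p)"
  by (simp add: carrier_Bp)

lemma to_Bp_qcls: "to_Bp p x = qcls (\<lambda>_. x)"
  by (cases x) (simp add: qcls_def padic_of_rat_cls)

lemma qcls_mult:
  "quat_seq F \<Longrightarrow> quat_seq G \<Longrightarrow>
     qcls F \<otimes>\<^bsub>Bp a b p\<^esub> qcls G = qcls (\<lambda>n. qmul a b (F n) (G n))"
  by (simp add: Bp_def quat_alg_def qcls_def quat_seq_def padic_of_rat_cls cls_mult cls_add
      cls_diff qmul_def)

lemma qcls_add:
  "quat_seq F \<Longrightarrow> quat_seq G \<Longrightarrow> qcls F \<oplus>\<^bsub>Bp a b p\<^esub> qcls G = qcls (\<lambda>n. F n + G n)"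
  by (simp add: Bp_def quat_alg_def qcls_def quat_seq_def cls_add)

lemma qcls_scale:
  "padic_seq f \<Longrightarrow> quat_seq G \<Longrightarrow>
     cls f \<odot>\<^bsub>Bp a b p\<^esub> qcls G = qcls (\<lambda>n. qscale (f n) (G n))"
  by (simp add: Bp_def quat_alg_def qcls_def quat_seq_def cls_mult)

lemma one_Bp: "\<one>\<^bsub>Bp a b p\<^esub> = qcls (\<lambda>_. qof 1)"
  by (simp add: Bp_def quat_alg_def qcls_def one_Qp zero_Qp)

lemma zero_Bp: "\<zero>\<^bsub>Bp a b p\<^esub> = qcls (\<lambda>_. 0)"
  by (simp add: Bp_def quat_alg_def qcls_def zero_Qp)

lemma nrd_qcls:
  "quat_seq F \<Longrightarrow>
     nrd (Qp p) (padic_of_rat p a) (padic_of_rat p b) (qcls F) = cls (\<lambda>n. qnrd a b (F n))"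
  by (simp add: nrd_def qcls_def quat_seq_def padic_of_rat_cls cls_mult cls_add cls_diff qnrd_def)

lemma qcls_eq_iff:
  "qcls F = qcls G \<longleftrightarrow> null_seq (\<lambda>n. q_one (F n - G n)) \<and> null_seq (\<lambda>n. q_i (F n - G n)) \<and>
     null_seq (\<lambda>n. q_j (F n - G n)) \<and> null_seq (\<lambda>n. q_k (F n - G n))"
  by (simp add: qcls_def cls_eq_iff)

lemma qcls_const_eq_iff [simp]: "qcls (\<lambda>_. x) = qcls (\<lambda>_. y) \<longleftrightarrow> x = y"
  by (auto simp: qcls_eq_iff quat_eq_iff[of x y])

lemma abelian_monoid_Bp: "abelian_monoid (Bp a b p)"
proof (rule abelian_monoidI)
  fix x y z
  assume "x \<in> carrier (Bp a b p)" "y \<in> carrier (Bp a b p)" "z \<in> carrier (Bp a b p)"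
  then obtain F G H where *: "quat_seq F" "quat_seq G" "quat_seq H"
    "x = qcls F" "y = qcls G" "z = qcls H"
    by (auto simp: carrier_Bp)
  show "(x \<oplus>\<^bsub>Bp a b p\<^esub> y) \<oplus>\<^bsub>Bp a b p\<^esub> z = x \<oplus>\<^bsub>Bp a b p\<^esub> (y \<oplus>\<^bsub>Bp a b p\<^esub> z)"
    using * by (simp add: qcls_add add.assoc)
qed (auto simp: carrier_Bp qcls_add zero_Bp add.commute)

lemma abs_Bp_to_Bp: "abs_Bp a b p (to_Bp p x) = sqrt (av (qnrd a b x))"
proof (cases "qnrd a b x = 0")
  case True
  then show ?thesis
    by (simp add: abs_Bp_def to_Bp_qcls nrd_qcls zero_Qp)
next
  case False
  then have "abs_Bp a b p (to_Bp p x) = real p powr (- (real_of_int (padic_val_rat p (qnrd a b x)) / 2))"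
    by (simp add: abs_Bp_def w_Bp_def to_Bp_qcls nrd_qcls zero_Qp cls_eq_iff padic_val_of_rat)
  also have "\<dots> = sqrt (real p powi (- padic_val_rat p (qnrd a b x)))"
    using p_gt_1 by (simp add: powr_half_sqrt[symmetric] powr_real_of_int'[symmetric] powr_powr)
  finally show ?thesis
    using False by (simp add: padic_abs_rat_def)
qed

end

section \<open>The ultrametric inequality for a division quaternion algebra\<close>

definition qinv :: "'k::field \<Rightarrow> 'k \<Rightarrow> 'k quat \<Rightarrow> 'k quat" where
  "qinv a b x = qscale (inverse (qnrd a b x)) (qconj x)"

lemma qmul_qinv: "qnrd a b x \<noteq> 0 \<Longrightarrow> qmul a b x (qinv a b x) = qof 1"
  by (simp add: qinv_def qmul_qscale_right qmul_qconj) (simp add: quat_eq_iff)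

lemma qinv_qmul: "qnrd a b x \<noteq> 0 \<Longrightarrow> qmul a b (qinv a b x) x = qof 1"
  by (simp add: qinv_def qmul_qscale_left qconj_qmul) (simp add: quat_eq_iff)

lemma qnrd_qinv: "qnrd a b x \<noteq> 0 \<Longrightarrow> qnrd a b (qinv a b x) = inverse (qnrd a b x)"
  using qnrd_qmul[of a b x "qinv a b x"] by (simp add: qmul_qinv field_simps)

context padic_prime
begin

text \<open>Over an ultrametric it suffices to control consecutive differences; this replaces the
geometric series.\<close>

lemma ultrametric_Cauchy:
  assumes r: "0 \<le> r" "r < 1" and step: "\<And>k. av (f (Suc k) - f k) \<le> r ^ k"
  shows "padic_seq f"
proof (rule padic_seqI)
  fix e :: real
  assume "e > 0"
  have "(\<lambda>k. r ^ k) \<longlonglongrightarrow> 0"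
    using r by (intro LIMSEQ_realpow_zero)
  then have "\<forall>\<^sub>F k in sequentially. r ^ k < e"
    using \<open>e > 0\<close> by (rule order_tendstoD)
  then obtain K where K: "r ^ K < e"
    by (auto simp: eventually_sequentially)
  have tail: "av (f m - f K) \<le> r ^ K" if "m \<ge> K" for m
    using that
  proof (induction m rule: dec_induct)
    case (step m)
    have "r ^ m \<le> r ^ K"
      using r step by (intro power_decreasing) auto
    then have "av (f (Suc m) - f m) \<le> r ^ K"
      using assms(3)[of m] by simp
    then show ?case
      using step av_add_le_max[of "f (Suc m) - f m" "f m - f K"] by simp
  qed (use r in simp)
  have "av (f m - f n) < e" if "m \<ge> K" "n \<ge> K" for m n
    using tail[OF that(1)] tail[OF that(2)] K av_diff_le_max[of "f m - f K" "f n - f K"] by simp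
  then show "\<exists>K. \<forall>m\<ge>K. \<forall>n\<ge>K. av (f m - f n) < e"
    by blast
qed

end

locale division_at_prime = padic_prime +
  fixes a b :: rat
  assumes division_Bp: "is_division_ring (Bp a b p)"
begin

sublocale Bp: ring "Bp a b p"
  using division_Bp by (simp add: is_division_ring_def)

text \<open>In a division algebra the norm form is anisotropic, because an element times its conjugate is its
reduced norm. The version for sequences covers elements with irrational coordinates, which
\<open>av_trace_le_1\<close> needs.\<close>

lemma qcls_eq_0_of_null_nrd:
  assumes F: "quat_seq F" and null: "null_seq (\<lambda>n. qnrd a b (F n))"
  shows "qcls F = \<zero>\<^bsub>Bp a b p\<^esub>"
proof (rule ccontr)
  assume "qcls F \<noteq> \<zero>\<^bsub>Bp a b p\<^esub>"
  then have unit: "qcls F \<in> Units (Bp a b p)"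
    using division_Bp F unfolding is_division_ring_def by auto
  have "qcls F \<otimes>\<^bsub>Bp a b p\<^esub> qcls (\<lambda>n. qconj (F n)) = qcls (\<lambda>n. qof (qnrd a b (F n)))"
    using F by (simp add: qcls_mult qmul_qconj)
  also have "\<dots> = \<zero>\<^bsub>Bp a b p\<^esub>"
    using null by (simp add: zero_Bp qcls_eq_iff)
  finally have "inv\<^bsub>Bp a b p\<^esub> qcls F \<otimes>\<^bsub>Bp a b p\<^esub> (qcls F \<otimes>\<^bsub>Bp a b p\<^esub> qcls (\<lambda>n. qconj (F n)))
      = \<zero>\<^bsub>Bp a b p\<^esub>"
    using unit by simp
  then have "qcls (\<lambda>n. qconj (F n)) = \<zero>\<^bsub>Bp a b p\<^esub>"
    using unit F by (simp add: Bp.m_assoc[symmetric])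
  then have "qcls F = \<zero>\<^bsub>Bp a b p\<^esub>"
    using null_seq_minus[of "\<lambda>n. - q_i (F n)"] null_seq_minus[of "\<lambda>n. - q_j (F n)"]
      null_seq_minus[of "\<lambda>n. - q_k (F n)"]
    by (auto simp: zero_Bp qcls_eq_iff)
  with \<open>qcls F \<noteq> \<zero>\<^bsub>Bp a b p\<^esub>\<close> show False
    by simp
qed

lemma qnrd_eq_0_iff [simp]: "qnrd a b x = 0 \<longleftrightarrow> x = 0"
  using qcls_eq_0_of_null_nrd[of "\<lambda>_. x"] by (auto simp: zero_Bp)

lemma to_Bp_diff: "to_Bp p x \<ominus>\<^bsub>Bp a b p\<^esub> to_Bp p y = to_Bp p (x - y)"
proof -
  have "to_Bp p x = to_Bp p (x - y) \<oplus>\<^bsub>Bp a b p\<^esub> to_Bp p y"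
    by (simp add: to_Bp_qcls qcls_add)
  moreover have "to_Bp p z \<in> carrier (Bp a b p)" for z
    by (simp add: to_Bp_qcls)
  ultimately show ?thesis
    by (simp add: Bp.minus_eq Bp.a_assoc Bp.r_neg)
qed

lemma to_Bp_inv:
  assumes "x \<noteq> 0"
  shows "inv\<^bsub>Bp a b p\<^esub> (to_Bp p x) = to_Bp p (qinv a b x)"
proof -
  have "inv\<^bsub>Bp a b p\<^esub> (to_Bp p x) = to_Bp p (qinv a b x)"
    using assms
    by (intro Bp.inv_unique'[symmetric])
       (auto simp: to_Bp_qcls qcls_mult one_Bp qmul_qinv qinv_qmul)
  then show ?thesis .
qed

text \<open>An element of integral norm \<open>n\<close> has integral trace \<open>T\<close>. Otherwise the polynomial
\<open>X\<^sup>2 - T X + n\<close> would have Newton slopes of different size and hence a root in \<open>Qp p\<close>, as in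
Hensel's lemma: the iteration \<open>t \<mapsto> n / (T - t)\<close> is a contraction starting from 0, and its limit
\<open>\<tau>\<close> satisfies \<open>\<tau>\<^sup>2 - T \<tau> + n = 0\<close>. The left side is the reduced norm of \<open>x - \<tau>\<close>, so
\<open>x = \<tau>\<close> in the division algebra. Then \<open>x\<close> is a rational scalar with \<open>n = x\<^sup>2\<close> and
\<open>T = 2 x\<close>, and the integrality of \<open>n\<close> forces that of \<open>T\<close>. As \<open>x\<close> is rational, the iteration
runs through rational numbers and represents \<open>\<tau>\<close>.\<close>

lemma av_trace_le_1:
  assumes n: "av (qnrd a b x) \<le> 1"
  shows "av (2 * q_one x) \<le> 1"
proof (rule ccontr)
  assume "\<not> av (2 * q_one x) \<le> 1"
  define T where "T = 2 * q_one x"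
  define n where "n = qnrd a b x"
  have T: "av T > 1"
    using \<open>\<not> av (2 * q_one x) \<le> 1\<close> unfolding T_def by linarith
  have n1: "av n \<le> 1"
    using n n_def by simp
  (* the fixed points of y |-> n / (T - y) are the roots of y^2 - T y + n; 0 is close to the
     small root *)
  define t where "t = rec_nat 0 (\<lambda>_ y. n / (T - y))"
  have t_0: "t 0 = 0" and t_Suc: "t (Suc k) = n / (T - t k)" for k
    by (simp_all add: t_def)
  have avTt: "av (T - t k) = av T" if "av (t k) < 1" for k
    using av_eq_of_close[of "T - t k" T] that T by simp
  have t_lt: "av (t k) < 1" for k
  proof (induction k)
    case (Suc k)
    moreover have "av n / av T < 1"
      using T n1 by (simp add: divide_less_eq)
    ultimately show ?case
      by (simp add: t_Suc avTt)
  qed (simp add: t_0)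
  note avTt = avTt[OF t_lt]
  have Tt: "T - t k \<noteq> 0" for k
    using avTt[of k] T by (metis av_0 less_irrefl not_one_less_zero)
  (* the contraction factor: n is integral and both denominators have the size of T *)
  define r where "r = 1 / (av T * av T)"
  have TT: "av T * av T > 1"
    using T by (simp add: less_1_mult)
  have r: "0 \<le> r" "r < 1"
    using TT by (simp_all add: r_def)
  have step: "av (t (Suc k) - t k) \<le> r ^ k" for k
  proof (induction k)
    case 0
    then show ?case
      using T n1 by (simp add: t_Suc t_0 divide_le_eq)
  next
    case (Suc k)
    have "t (Suc (Suc k)) - t (Suc k) = n * (t (Suc k) - t k) / ((T - t (Suc k)) * (T - t k))"
    proof -
      have "t (Suc (Suc k)) - t (Suc k) = n / (T - t (Suc k)) - n / (T - t k)"
        by (rule arg_cong2[of _ _ _ _ "(-)"]) (rule t_Suc)+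
      also have "\<dots> = n * (t (Suc k) - t k) / ((T - t (Suc k)) * (T - t k))"
        using Tt[of k] Tt[of "Suc k"]
        by (simp add: diff_frac_eq right_diff_distrib left_diff_distrib mult.commute)
      finally show ?thesis .
    qed
    then have "av (t (Suc (Suc k)) - t (Suc k)) = av n * av (t (Suc k) - t k) * r"
      by (simp add: avTt r_def)
    also have "\<dots> \<le> 1 * r ^ k * r"
      using Suc n1 r by (intro mult_mono) auto
    finally show ?case
      by (simp add: mult.commute)
  qed
  have t_seq: "padic_seq t"
    using r step by (rule ultrametric_Cauchy)
  have nrd: "qnrd a b (x - qof (t k)) = (t (Suc k) - t k) * (T - t k)" for k
  proof -
    have "n = t (Suc k) * (T - t k)"
      using Tt by (simp add: t_Suc)
    then show ?thesis
      by (simp add: qnrd_qof_diff n_def[symmetric] T_def algebra_simps power2_eq_square)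
  qed
  have "null_seq (\<lambda>k. qnrd a b (x - qof (t k)))"
    unfolding null_seq_iff
  proof (intro allI impI)
    fix e :: real
    assume "e > 0"
    have "(\<lambda>k. r ^ k * av T) \<longlonglongrightarrow> 0 * av T"
      using r by (intro tendsto_intros LIMSEQ_realpow_zero)
    then have "\<forall>\<^sub>F k in sequentially. r ^ k * av T < e"
      using \<open>e > 0\<close> by (intro order_tendstoD(2)) auto
    then show "\<forall>\<^sub>F k in sequentially. av (qnrd a b (x - qof (t k))) < e"
    proof eventually_elim
      case (elim k)
      have "av (qnrd a b (x - qof (t k))) \<le> r ^ k * av T"
        using step[of k] T by (simp add: nrd avTt mult_right_mono)
      with elim show ?case
        by simp
    qed
  qed
  then have "qcls (\<lambda>k. x - qof (t k)) = \<zero>\<^bsub>Bp a b p\<^esub>"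
    using t_seq by (intro qcls_eq_0_of_null_nrd) auto
  then have "q_i x = 0" "q_j x = 0" "q_k x = 0"
    by (simp_all add: zero_Bp qcls_eq_iff)
  then have "n = q_one x * q_one x"
    by (simp add: n_def qnrd_def)
  then have "av (q_one x) * av (q_one x) \<le> 1"
    using n1 by simp
  then have "av (q_one x) \<le> 1"
    by (meson less_1_mult linorder_not_less)
  moreover have "av 2 \<le> 1"
    using av_of_int_le_1[of 2] by simp
  ultimately have "av T \<le> 1"
    unfolding T_def by (simp add: mult_le_one)
  with T show False
    by simp
qed

text \<open>Dividing by the larger summand reduces the claim to \<open>z + 1\<close> with \<open>z\<close> of integral norm, and the
norm of \<open>z + 1\<close> is \<open>1 + trd z + nrd z\<close>, where the trace is integral by \<open>av_trace_le_1\<close>.\<close>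

lemma av_qnrd_add_le_max:
  "av (qnrd a b (x + y)) \<le> max (av (qnrd a b x)) (av (qnrd a b y))"
proof -
  have one: "av (qnrd a b (z + qof 1)) \<le> 1" if z: "av (qnrd a b z) \<le> 1" for z
  proof -
    have "z + qof 1 = z - qof (-1)"
      by (simp add: quat_eq_iff)
    then have "qnrd a b (z + qof 1) = 1 + (qnrd a b z + 2 * q_one z)"
      by (simp add: qnrd_qof_diff)
    moreover have "av (qnrd a b z + 2 * q_one z) \<le> 1"
      using av_add_le_max[of "qnrd a b z" "2 * q_one z"] av_trace_le_1[OF z] z by linarith
    ultimately show ?thesis
      using av_one_plus_le by simp
  qed
  have *: "av (qnrd a b (x + y)) \<le> av (qnrd a b y)" if le: "av (qnrd a b x) \<le> av (qnrd a b y)" for x y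
  proof (cases "y = 0")
    case True
    then show ?thesis
      using le by simp
  next
    case False
    define z where "z = qmul a b x (qinv a b y)"
    have "av (qnrd a b z) \<le> 1"
      using False le by (simp add: z_def qnrd_qmul qnrd_qinv field_simps del: av_mult)
    then have "av (qnrd a b (z + qof 1)) \<le> 1"
      by (rule one)
    moreover have "x + y = qmul a b (z + qof 1) y"
      using False by (simp add: z_def qmul_add_left qmul_assoc qinv_qmul)
    ultimately show ?thesis
      by (simp add: qnrd_qmul mult_left_le_one_le)
  qed
  show ?thesis
    using *[of x y] *[of y x] by (cases "av (qnrd a b x) \<le> av (qnrd a b y)") (auto simp: add.commute max_def)
qed

end

section \<open>Orders and their localizations\<close>

lemma abelian_monoid_BQ: "abelian_monoid (BQ a b)"
  by (rule abelian_monoidI) (auto simp: BQ_simps add.assoc add.commute)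

lemma finsum_BQ: "(\<Oplus>\<^bsub>BQ a b\<^esub>i\<in>{..<n::nat}. f i) = (\<Sum>i<n. f i)"
proof -
  interpret abelian_monoid "BQ a b"
    by (rule abelian_monoid_BQ)
  show ?thesis
    by (induction n) (auto simp: BQ_simps lessThan_Suc)
qed

lemma lin_combs_BQ:
  "lin_combs (BQ a b) C S =
     {v. \<exists>(n::nat) c x. (\<forall>i<n. c i \<in> C \<and> x i \<in> S) \<and> v = (\<Sum>i<n. qscale (c i) (x i))}"
  by (simp add: lin_combs_def finsum_BQ BQ_simps)

lemma rat_common_denominator:
  fixes A :: "rat set"
  assumes "finite A"
  shows "\<exists>D>0. \<forall>x\<in>A. of_int D * x \<in> \<int>"
  using assms
proof (induction A)
  case (insert x A)
  then obtain D where D: "D > 0" "\<forall>x\<in>A. of_int D * x \<in> \<int>"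
    by blast
  obtain m d where q: "quotient_of x = (m, d)"
    by fastforce
  have d: "d > 0" "x = of_int m / of_int d"
    using quotient_of_denom_pos[OF q] quotient_of_div[OF q] by auto
  have "of_int (D * d) * y \<in> \<int>" if "y \<in> insert x A" for y
  proof (cases "y = x")
    case True
    then show ?thesis
      using d by simp
  next
    case False
    then have "of_int D * y \<in> \<int>"
      using that D by auto
    then have "of_int d * (of_int D * y) \<in> \<int>"
      by (rule Ints_mult[OF Ints_of_int])
    then show ?thesis
      by (simp add: mult_ac)
  qed
  then show ?case
    using D(1) d(1) by (intro exI[of _ "D * d"]) auto
qed (auto intro: exI[of _ 1])

definition qintegral :: "rat quat \<Rightarrow> bool" where
  "qintegral x \<longleftrightarrow> q_one x \<in> \<int> \<and> q_i x \<in> \<int> \<and> q_j x \<in> \<int> \<and> q_k x \<in> \<int>"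

locale quaternion_order =
  fixes a b :: rat and R :: "rat quat set"
  assumes order: "quat_order a b R"
begin

lemma R_one: "qof 1 \<in> R"
  and R_mult: "x \<in> R \<Longrightarrow> y \<in> R \<Longrightarrow> qmul a b x y \<in> R"
  and R_add: "x \<in> R \<Longrightarrow> y \<in> R \<Longrightarrow> x + y \<in> R"
proof -
  have R: "subring R (BQ a b)"
    using order by (simp add: quat_order_def)
  show "qof 1 \<in> R" "x \<in> R \<Longrightarrow> y \<in> R \<Longrightarrow> qmul a b x y \<in> R"
      "x \<in> R \<Longrightarrow> y \<in> R \<Longrightarrow> x + y \<in> R"
    using subringE(3)[OF R] subringE(6)[OF R, of x y] subringE(7)[OF R, of x y]
    by (simp_all add: BQ_simps)
qed

lemma R_lattice:
  obtains S where "finite S"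
    "R = {v. \<exists>(n::nat) c x. (\<forall>i<n. c i \<in> \<int> \<and> x i \<in> S) \<and> v = (\<Sum>i<n. qscale (c i) (x i))}"
  using order unfolding quat_order_def lin_combs_BQ by blast

lemma R_scale:
  assumes "x \<in> R"
  shows "qscale (of_int m) x \<in> R"
proof -
  obtain S where S: 
    "R = {v. \<exists>(n::nat) c x. (\<forall>i<n. c i \<in> \<int> \<and> x i \<in> S) \<and> v = (\<Sum>i<n. qscale (c i) (x i))}"
    by (rule R_lattice)
  obtain n c y where x: "\<forall>i<(n::nat). c i \<in> \<int> \<and> y i \<in> S" "x = (\<Sum>i<n. qscale (c i) (y i))"
    using assms unfolding S mem_Collect_eq by (elim exE conjE) (rule that)
  have "qscale (of_int m) x = (\<Sum>i<n. qscale (of_int m * c i) (y i))"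
    unfolding x(2) by (simp add: quat_eq_iff quat_sum_sel sum_distrib_left mult.assoc)
  moreover have "\<forall>i<n. of_int m * c i \<in> \<int> \<and> y i \<in> S"
    using x(1) by auto
  ultimately show ?thesis
    unfolding S mem_Collect_eq
    by (intro exI[of _ n] exI[of _ "\<lambda>i. of_int m * c i"] exI[of _ y]) blast
qed

lemma R_0: "0 \<in> R"
  using R_scale[OF R_one, of 0] by (simp add: qscale_def zero_quat_def)

text \<open>A finitely generated subgroup has bounded denominators, whereas a spanning one, by \<open>R_full\<close>
below, contains a multiple of every element. The first fact makes reduced norms on \<open>R\<close> almost
integral, the second lets \<open>R\<close> absorb p-adically small errors.\<close>

lemma R_denominator:
  obtains D :: int where "D > 0" "\<And>x. x \<in> R \<Longrightarrow> qintegral (qscale (of_int D) x)"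
proof -
  obtain S where S: "finite S"
    "R = {v. \<exists>(n::nat) c x. (\<forall>i<n. c i \<in> \<int> \<and> x i \<in> S) \<and> v = (\<Sum>i<n. qscale (c i) (x i))}"
    by (rule R_lattice)
  obtain D where D: "D > 0" "\<forall>x\<in>(\<Union>s\<in>S. {q_one s, q_i s, q_j s, q_k s}). of_int D * x \<in> \<int>"
    using rat_common_denominator[of "\<Union>s\<in>S. {q_one s, q_i s, q_j s, q_k s}"] S(1) by auto
  have "qintegral (qscale (of_int D) x)" if "x \<in> R" for x
  proof -
    obtain n c y where x: "\<forall>i<(n::nat). c i \<in> \<int> \<and> y i \<in> S" "x = (\<Sum>i<n. qscale (c i) (y i))"
      using \<open>x \<in> R\<close> unfolding S(2) mem_Collect_eq by (elim exE conjE) (rule that)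
    have *: "of_int D * (\<Sum>i<n. c i * f (y i)) \<in> \<int>" if "\<And>s. s \<in> S \<Longrightarrow> of_int D * f s \<in> \<int>" for f
    proof -
      have "of_int D * (\<Sum>i<n. c i * f (y i)) = (\<Sum>i<n. c i * (of_int D * f (y i)))"
        by (simp add: sum_distrib_left mult_ac)
      also have "\<dots> \<in> \<int>"
      proof (rule Ints_sum)
        fix i assume "i \<in> {..<n}"
        then show "c i * (of_int D * f (y i)) \<in> \<int>"
          using x(1) that[of "y i"] by (metis Ints_mult lessThan_iff)
      qed
      finally show ?thesis .
    qed
    show ?thesis
      unfolding x(2) qintegral_def using D(2)
      by (auto simp: quat_sum_sel intro!: *)
  qed
  with D(1) that show ?thesis
    by blast
qed

lemma R_full: "\<exists>e>0. qscale (of_int e) x \<in> R"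
proof -
  have "x \<in> lin_combs (BQ a b) UNIV R"
    using order by (simp add: quat_order_def BQ_simps)
  then obtain n c y where y: "\<forall>i<(n::nat). y i \<in> R" and x: "x = (\<Sum>i<n. qscale (c i) (y i))"
    unfolding lin_combs_BQ by blast
  obtain D where D: "D > 0" "\<forall>x\<in>c ` {..<n}. of_int D * x \<in> \<int>"
    using rat_common_denominator[of "c ` {..<n}"] by auto
  have "(\<Sum>i<m. qscale (of_int D * c i) (y i)) \<in> R" if "m \<le> n" for m
    using that
  proof (induction m)
    case (Suc m)
    then obtain k where "of_int D * c m = of_int k"
      using D(2) by (metis Ints_cases Suc_le_lessD imageI lessThan_iff)
    with Suc y show ?case
      by (auto intro!: R_add R_scale)
  qed (simp add: R_0)
  then have "(\<Sum>i<n. qscale (of_int D * c i) (y i)) \<in> R"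
    by blast
  also have "(\<Sum>i<n. qscale (of_int D * c i) (y i)) = qscale (of_int D) x"
    unfolding x by (simp add: quat_eq_iff quat_sum_sel sum_distrib_left mult.assoc)
  finally show ?thesis
    using D(1) by blast
qed

lemma qnrd_denominator:
  obtains E :: int where "E > 0" "\<And>x. x \<in> R \<Longrightarrow> of_int E * qnrd a b x \<in> \<int>"
proof -
  obtain D :: int where D: "D > 0" "\<And>x. x \<in> R \<Longrightarrow> qintegral (qscale (of_int D) x)"
    using R_denominator by blast
  obtain d where d: "d > 0" "of_int d * a \<in> \<int>" "of_int d * b \<in> \<int>"
    using rat_common_denominator[of "{a, b}"] by auto
  define a' b' where "a' = of_int d * a" and "b' = of_int d * b"
  have ab': "a' \<in> \<int>" "b' \<in> \<int>"
    using d by (simp_all add: a'_def b'_def)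
  have "of_int (D\<^sup>2 * d\<^sup>2) * qnrd a b x \<in> \<int>" if "x \<in> R" for x
  proof -
    define y where "y = qscale (of_int D) x"
    have y: "q_one y \<in> \<int>" "q_i y \<in> \<int>" "q_j y \<in> \<int>" "q_k y \<in> \<int>"
      using D(2)[OF that] by (simp_all add: qintegral_def y_def)
    have "of_int (D\<^sup>2 * d\<^sup>2) * qnrd a b x = of_int (d\<^sup>2) * qnrd a b y"
      by (simp add: y_def qnrd_qscale mult_ac)
    also have "\<dots> = of_int (d\<^sup>2) * (q_one y * q_one y)
        - of_int d * a' * (q_i y * q_i y) - of_int d * b' * (q_j y * q_j y)
        + a' * b' * (q_k y * q_k y)"
      by (simp add: qnrd_def a'_def b'_def algebra_simps power2_eq_square)
    also have "\<dots> \<in> \<int>"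
      using y ab' by (intro Ints_add Ints_diff Ints_mult) auto
    finally show ?thesis .
  qed
  moreover have "D\<^sup>2 * d\<^sup>2 > 0"
    using D(1) d(1) by simp
  ultimately show ?thesis
    using that by blast
qed


text \<open>The localization of \<open>R\<close> at the prime \<open>q\<close>, inside the rational algebra. It serves to replace the
completion of \<open>R\<close> at \<open>q\<close> by something that can be glued over all \<open>q\<close>.\<close>

definition R_at :: "nat \<Rightarrow> rat quat set" where
  "R_at q = {x. \<exists>m::int. \<not> int q dvd m \<and> qscale (of_int m) x \<in> R}"

text \<open>The order \<open>R[1/p]\<close>.\<close>

definition R_away :: "nat \<Rightarrow> rat quat set" where
  "R_away p = {x. \<exists>k. qscale (of_nat p ^ k) x \<in> R}"

text \<open>The integers \<open>m\<close> with \<open>m x \<in> R\<close> form an ideal. Its positive generator is divisible by no prime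
other than \<open>p\<close>, since the ideal contains an integer prime to each such prime.\<close>

lemma R_away_if_R_at:
  assumes p: "Factorial_Ring.prime p"
    and x: "\<And>q. Factorial_Ring.prime q \<Longrightarrow> q \<noteq> p \<Longrightarrow> x \<in> R_at q"
  shows "x \<in> R_away p"
proof -
  define P where "P m \<longleftrightarrow> m > 0 \<and> qscale (of_nat m) x \<in> R" for m :: nat
  define m where "m = (LEAST m. P m)"
  obtain e where e: "e > 0" "qscale (of_int e) x \<in> R"
    using R_full by blast
  then have "P (nat e)"
    by (simp add: P_def)
  then have m: "P m" and m_least: "\<And>k. P k \<Longrightarrow> m \<le> k"
    unfolding m_def by (auto intro: LeastI Least_le)
  have "m \<noteq> 0" "\<not> is_unit p"
    using m p by (auto simp: P_def)
  then obtain r where "m = p ^ multiplicity p m * r" "\<not> p dvd r"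
    by (rule multiplicity_decompose')
  then obtain k where kr: "m = p ^ k * r" "\<not> p dvd r"
    by blast
  have "r = 1"
  proof (rule ccontr)
    assume "r \<noteq> 1"
    then obtain q where q: "Factorial_Ring.prime q" "q dvd r"
      using prime_factor_nat by blast
    then have "q \<noteq> p"
      using kr by auto
    then obtain l :: int where l: "\<not> int q dvd l" "qscale (of_int l) x \<in> R"
      using x q by (auto simp: R_at_def)
    define g where "g = gcd (int m) l"
    obtain u v where uv: "u * int m + v * l = g"
      unfolding g_def using bezout_int by blast
    have "qscale (of_int g) x = 
        qscale (of_int u) (qscale (of_nat m) x) + qscale (of_int v) (qscale (of_int l) x)"
      by (simp add: uv[symmetric] qscale_qscale qscale_add_left)
    also have "\<dots> \<in> R"
      using R_add[OF R_scale R_scale[OF l(2)]] m unfolding P_def by blast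
    finally have "P (nat g)"
      using m by (simp add: P_def g_def)
    then have "m \<le> nat g"
      by (rule m_least)
    moreover have "nat g dvd m"
      unfolding g_def by (metis gcd_dvd1 gcd_ge_0_int int_dvd_int_iff nat_0_le)
    ultimately have "nat g = m"
      using m by (simp add: P_def dvd_imp_le order_antisym)
    then have "int m = g"
      unfolding g_def by (metis gcd_ge_0_int nat_0_le)
    then have "int m dvd l"
      unfolding g_def by (metis gcd_dvd2)
    moreover have "int q dvd int m"
      using q(2) kr(1) by simp
    ultimately show False
      using l(1) dvd_trans by blast
  qed
  then show ?thesis
    using m kr unfolding P_def R_away_def by auto
qed

lemma R_scale_prime_power_mono:
  assumes "qscale (of_nat p ^ k) x \<in> R" "k \<le> l"
  shows "qscale (of_nat p ^ l) x \<in> R"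
proof -
  have "qscale (of_int (int p ^ (l - k))) (qscale (of_nat p ^ k) x) \<in> R"
    by (rule R_scale[OF assms(1)])
  also have "qscale (of_int (int p ^ (l - k))) (qscale (of_nat p ^ k) x) = qscale (of_nat p ^ l) x"
    using assms(2) by (simp add: qscale_qscale power_add[symmetric])
  finally show ?thesis .
qed

lemma R_away_diff:
  assumes "x \<in> R_away p" "y \<in> R_away p"
  shows "x - y \<in> R_away p"
proof -
  obtain k l where "qscale (of_nat p ^ k) x \<in> R" "qscale (of_nat p ^ l) y \<in> R"
    using assms by (auto simp: R_away_def)
  then have "qscale (of_nat p ^ (max k l)) x \<in> R" "qscale (of_nat p ^ (max k l)) y \<in> R"
    by (auto intro: R_scale_prime_power_mono)
  then have "qscale (of_nat p ^ (max k l)) x + qscale (of_int (-1)) (qscale (of_nat p ^ (max k l)) y) \<in> R"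
    by (intro R_add R_scale)
  also have "qscale (of_nat p ^ (max k l)) x + qscale (of_int (-1)) (qscale (of_nat p ^ (max k l)) y)
     = qscale (of_nat p ^ (max k l)) (x - y)"
    by (simp add: quat_eq_iff algebra_simps)
  finally show ?thesis
    unfolding R_away_def by blast
qed

lemma R_away_mult:
  assumes "x \<in> R_away p" "y \<in> R_away p"
  shows "qmul a b x y \<in> R_away p"
proof -
  obtain k l where "qscale (of_nat p ^ k) x \<in> R" "qscale (of_nat p ^ l) y \<in> R"
    using assms by (auto simp: R_away_def)
  then have "qmul a b (qscale (of_nat p ^ k) x) (qscale (of_nat p ^ l) y) \<in> R"
    by (rule R_mult)
  then have "qscale (of_nat p ^ (k + l)) (qmul a b x y) \<in> R"
    by (simp add: qmul_qscale_left qmul_qscale_right qscale_qscale power_add mult.commute)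
  then show ?thesis
    unfolding R_away_def by blast
qed

lemma R_subset_R_away: "R \<subseteq> R_away p"
  unfolding R_away_def by (auto intro!: exI[of _ 0])

text \<open>Reduced norms on \<open>R[1/p]\<close> lie in \<open>1/E Z[1/p]\<close> for a fixed \<open>E\<close>, and the product of the p-adic and
the archimedean absolute value is unchanged by powers of \<open>p\<close>. So the bound for nonzero integers
passes to all nonzero norms, up to the factor \<open>E\<close>.\<close>

lemma R_away_product_formula:
  assumes p: "Factorial_Ring.prime p"
  obtains \<epsilon> :: real where "\<epsilon> > 0"
    "\<And>x. x \<in> R_away p \<Longrightarrow> qnrd a b x \<noteq> 0 \<Longrightarrow>
       padic_abs_rat p (qnrd a b x) * \<bar>real_of_rat (qnrd a b x)\<bar> \<ge> \<epsilon>"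
proof -
  interpret padic_prime p
    by unfold_locales (rule p)
  obtain E :: int where E: "E > 0" "\<And>x. x \<in> R \<Longrightarrow> of_int E * qnrd a b x \<in> \<int>"
    using qnrd_denominator by blast
  have "av (qnrd a b x) * \<bar>real_of_rat (qnrd a b x)\<bar> \<ge> 1 / of_int E"
    if x: "x \<in> R_away p" "qnrd a b x \<noteq> 0" for x
  proof -
    obtain k where k: "qscale (of_nat p ^ k) x \<in> R"
      using x by (auto simp: R_away_def)
    define N where "N = qnrd a b x"
    obtain m where m: "of_int E * ((of_nat p ^ k)\<^sup>2 * N) = of_int m"
      using E(2)[OF k] unfolding qnrd_qscale N_def by (auto elim: Ints_cases)
    have "m \<noteq> 0"
    proof
      assume "m = 0"
      then show False
        using m x(2) E(1) p_gt_1 by (simp add: N_def)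
    qed
    then have "1 \<le> av (of_int m) * \<bar>real_of_rat (of_int m)\<bar>"
      using av_product_ge_1 by simp
    also have "\<dots> = (av (of_int E) * av N) * (of_int E * \<bar>real_of_rat N\<bar>)"
      using p_gt_1 E(1) unfolding m[symmetric]
      by (simp add: av_p of_rat_mult of_rat_power abs_mult field_simps)
    also have "\<dots> \<le> (1 * av N) * (of_int E * \<bar>real_of_rat N\<bar>)"
      using E(1) by (intro mult_right_mono) auto
    finally show ?thesis
      using E(1) by (simp add: N_def field_simps)
  qed
  moreover have "1 / real_of_int E > 0"
    using E(1) by simp
  ultimately show ?thesis
    using that by blast
qed

end

locale order_at_prime = padic_prime p + quaternion_order a b R
  for p :: nat and a b :: rat and R :: "rat quat set"
begin

lemma R_at_add:
  assumes "x \<in> R_at p" "y \<in> R_at p"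
  shows "x + y \<in> R_at p"
proof -
  obtain m n :: int where *: "\<not> int p dvd m" "qscale (of_int m) x \<in> R"
    "\<not> int p dvd n" "qscale (of_int n) y \<in> R"
    using assms by (auto simp: R_at_def)
  have "qscale (of_int (m * n)) (x + y) =
      qscale (of_int n) (qscale (of_int m) x) + qscale (of_int m) (qscale (of_int n) y)"
    by (simp add: qscale_qscale qscale_add_right mult_ac)
  also have "\<dots> \<in> R"
    by (rule R_add[OF R_scale[OF *(2)] R_scale[OF *(4)]])
  finally have "qscale (of_int (m * n)) (x + y) \<in> R" .
  moreover have "\<not> int p dvd m * n"
    using * prime_p by (simp add: prime_dvd_mult_iff)
  ultimately show ?thesis
    unfolding R_at_def by blast
qed

lemma R_subset_R_at: "R \<subseteq> R_at p"
  unfolding R_at_def by (use prime_p in \<open>auto intro!: exI[of _ 1] dest: not_prime_unit\<close>)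

lemma R_at_scale:
  assumes x: "x \<in> R_at p" and u: "av u \<le> 1"
  shows "qscale u x \<in> R_at p"
proof -
  obtain k :: int where k: "\<not> int p dvd k" "qscale (of_int k) x \<in> R"
    using x by (auto simp: R_at_def)
  obtain m d where u: "u = of_int m / of_int d" "\<not> int p dvd d"
    using u by (rule av_le_1_cases)
  have "d \<noteq> 0"
    using u(2) by auto
  then have "qscale (of_int (d * k)) (qscale u x) = qscale (of_int m) (qscale (of_int k) x)"
    by (simp add: qscale_qscale u(1) mult_ac)
  then have "qscale (of_int (d * k)) (qscale u x) \<in> R"
    using k(2) R_scale by simp
  moreover have "\<not> int p dvd d * k"
    using k u prime_p by (simp add: prime_dvd_mult_iff)
  ultimately show ?thesis
    unfolding R_at_def by blast
qed

lemma R_at_small_scale: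
  shows "\<exists>\<delta>>0. \<forall>c. av c < \<delta> \<longrightarrow> qscale c x \<in> R_at p"
proof -
  obtain e where e: "e > 0" "qscale (of_int e) x \<in> R"
    using R_full by blast
  have "qscale c x \<in> R_at p" if "av c < av (of_int e)" for c
  proof -
    have "av (c / of_int e) \<le> 1"
      using that e(1) by simp
    moreover have "qscale (of_int e) x \<in> R_at p"
      using e(2) R_subset_R_at by blast
    ultimately have "qscale (c / of_int e) (qscale (of_int e) x) \<in> R_at p"
      by (rule R_at_scale[rotated])
    then show ?thesis
      using e(1) by (simp add: qscale_qscale)
  qed
  moreover have "av (of_int e) > 0"
    using e(1) by simp
  ultimately show ?thesis
    by blast
qed

lemma R_at_null_seq:
  assumes null: "f \<in> padic_null p"
  shows "\<forall>\<^sub>F n in sequentially. qscale (f n) x \<in> R_at p"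
proof -
  obtain \<delta> where "\<delta> > 0" "\<forall>c. av c < \<delta> \<longrightarrow> qscale c x \<in> R_at p"
    using R_at_small_scale by blast
  with null_seqD[OF null \<open>\<delta> > 0\<close>] show ?thesis
    by (auto elim: eventually_mono)
qed

text \<open>An element of the completion is a combination of elements of \<open>R\<close> with p-adic integer coefficients.
Replacing the coefficients by nearby rationals that are integral at \<open>p\<close> yields approximations in
the localization.\<close>

lemma order_completion_approx:
  assumes Y: "Y \<in> order_completion a b R p"
  shows "\<exists>F. quat_seq F \<and> Y = qcls F \<and>
           (\<forall>\<^sub>F n in sequentially. F n \<in> R_at p)"
proof -
  interpret B: abelian_monoid "Bp a b p"
    by (rule abelian_monoid_Bp)
  obtain n c x where c: "\<forall>i<(n::nat). c i \<in> Zp p \<and> x i \<in> to_Bp p ` R"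
    and Y: "Y = (\<Oplus>\<^bsub>Bp a b p\<^esub>i\<in>{..<n}. c i \<odot>\<^bsub>Bp a b p\<^esub> x i)"
    using Y unfolding order_completion_def lin_combs_def by blast
  have summand: "\<exists>F. quat_seq F \<and> c i \<odot>\<^bsub>Bp a b p\<^esub> x i = qcls F \<and>
      (\<forall>\<^sub>F n in sequentially. F n \<in> R_at p)" if "i < n" for i
  proof -
    obtain f where f: "padic_seq f" "c i = cls f" "\<forall>\<^sub>F n in sequentially. av (f n) \<le> 1"
      using c \<open>i < n\<close> Zp_cases by blast
    obtain r where r: "r \<in> R" "x i = to_Bp p r"
      using c \<open>i < n\<close> by blast
    have "\<forall>\<^sub>F n in sequentially. qscale (f n) r \<in> R_at p"
      using f(3)
    proof eventually_elim
      case (elim n)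
      then show ?case
        using r(1) R_subset_R_at by (intro R_at_scale) auto
    qed
    then show ?thesis
      using f(1) by (intro exI[of _ "\<lambda>n. qscale (f n) r"]) (simp add: f(2) r(2) to_Bp_qcls qcls_scale)
  qed
  have "\<exists>F. quat_seq F \<and> (\<Oplus>\<^bsub>Bp a b p\<^esub>i\<in>{..<m}. c i \<odot>\<^bsub>Bp a b p\<^esub> x i) = qcls F \<and>
      (\<forall>\<^sub>F n in sequentially. F n \<in> R_at p)" if "m \<le> n" for m
    using that
  proof (induction m)
    case 0
    show ?case
      using R_0 R_subset_R_at
      by (intro exI[of _ "\<lambda>_. 0"]) (auto simp: zero_Bp)
  next
    case (Suc m)
    obtain F where F: "quat_seq F" "(\<Oplus>\<^bsub>Bp a b p\<^esub>i\<in>{..<m}. c i \<odot>\<^bsub>Bp a b p\<^esub> x i) = qcls F"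
      "\<forall>\<^sub>F n in sequentially. F n \<in> R_at p"
      using Suc by auto
    obtain G where G: "quat_seq G" "c m \<odot>\<^bsub>Bp a b p\<^esub> x m = qcls G"
      "\<forall>\<^sub>F n in sequentially. G n \<in> R_at p"
      using summand[of m] Suc.prems by auto
    have carr: "c i \<odot>\<^bsub>Bp a b p\<^esub> x i \<in> carrier (Bp a b p)" if "i < n" for i
      using summand[OF that] by auto
    have "(\<Oplus>\<^bsub>Bp a b p\<^esub>i\<in>{..<Suc m}. c i \<odot>\<^bsub>Bp a b p\<^esub> x i) = qcls G \<oplus>\<^bsub>Bp a b p\<^esub> qcls F"
      unfolding lessThan_Suc using carr Suc.prems F(1,2) G(1,2)
      by (subst B.finsum_insert) (auto simp: Pi_iff)
    also have "\<dots> = qcls (\<lambda>n. G n + F n)"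
      using F(1) G(1) by (simp add: qcls_add)
    finally have "(\<Oplus>\<^bsub>Bp a b p\<^esub>i\<in>{..<Suc m}. c i \<odot>\<^bsub>Bp a b p\<^esub> x i) = qcls (\<lambda>n. G n + F n)" .
    moreover have "\<forall>\<^sub>F n in sequentially. G n + F n \<in> R_at p"
      using F(3) G(3) by eventually_elim (use R_at_add in blast)
    ultimately show ?case
      using F(1) G(1) by (intro exI[of _ "\<lambda>n. G n + F n"]) simp
  qed
  then show ?thesis
    unfolding Y by blast
qed

text \<open>A rational element of the completion differs from its approximations in the localization by
rational quaternions with small coordinates, and those lie in the localization because \<open>R\<close> is a
full lattice. So the localization is the intersection of the completion with the rational algebra,
of which this is the nontrivial inclusion.\<close>

lemma R_at_if_in_order_completion:
  assumes x: "to_Bp p x \<in> order_completion a b R p"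
  shows "x \<in> R_at p"
proof -
  obtain F where F: "quat_seq F" "to_Bp p x = qcls F" "\<forall>\<^sub>F n in sequentially. F n \<in> R_at p"
    using order_completion_approx[OF x] by blast
  have null: "null_seq (\<lambda>n. q_one (x - F n))" "null_seq (\<lambda>n. q_i (x - F n))"
    "null_seq (\<lambda>n. q_j (x - F n))" "null_seq (\<lambda>n. q_k (x - F n))"
    using F(2) by (simp_all add: to_Bp_qcls qcls_eq_iff)
  have "\<forall>\<^sub>F n in sequentially. x \<in> R_at p"
    using F(3) R_at_null_seq[OF null(1), of "Quat 1 0 0 0"]
      R_at_null_seq[OF null(2), of "Quat 0 1 0 0"]
      R_at_null_seq[OF null(3), of "Quat 0 0 1 0"]
      R_at_null_seq[OF null(4), of "Quat 0 0 0 1"]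
  proof eventually_elim
    case (elim n)
    have "x = F n + (qscale (q_one (x - F n)) (Quat 1 0 0 0) + (qscale (q_i (x - F n)) (Quat 0 1 0 0)
      + (qscale (q_j (x - F n)) (Quat 0 0 1 0) + qscale (q_k (x - F n)) (Quat 0 0 0 1))))"
      by (simp add: quat_eq_iff)
    also have "\<dots> \<in> R_at p"
      using elim by (intro R_at_add)
    finally show ?case .
  qed
  then show ?thesis
    by simp
qed

end

section \<open>The archimedean norm\<close>

text \<open>Hadamard's inequality: the columns are images of unit vectors, hence bounded by the operator norm.\<close>

lemma norm_det_le_onorm_squared:
  fixes M :: "'c::{real_normed_field, euclidean_space} ^ 2 ^ 2"
  shows "norm (det M) \<le> (onorm ((*v) M))\<^sup>2"
proof -
  have col: "sqrt ((norm (M $ 1 $ j))\<^sup>2 + (norm (M $ 2 $ j))\<^sup>2) \<le> onorm ((*v) M)" for j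
  proof -
    have "norm (M *v axis j 1) \<le> onorm ((*v) M) * norm (axis j 1 :: 'c ^ 2)"
      by (intro onorm matrix_vector_mul_bounded_linear)
    moreover have "norm (axis j 1 :: 'c ^ 2) = 1"
      using exhaust_2[of j] by (auto simp: norm_vec_def L2_set_def axis_def UNIV_2)
    moreover have "(M *v axis j 1) $ i = M $ i $ j" for i
      using exhaust_2[of j] by (auto simp: matrix_vector_mult_def axis_def sum_2)
    then have "norm (M *v axis j 1) = sqrt ((norm (M $ 1 $ j))\<^sup>2 + (norm (M $ 2 $ j))\<^sup>2)"
      by (simp add: norm_vec_def L2_set_def UNIV_2)
    ultimately show ?thesis
      by simp
  qed
  define u v w z where "u = norm (M $ 1 $ 1)" and "v = norm (M $ 2 $ 1)"
    and "w = norm (M $ 1 $ 2)" and "z = norm (M $ 2 $ 2)"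
  have "norm (det M) \<le> u * z + v * w"
    unfolding det_2 u_def v_def w_def z_def using norm_triangle_ineq4[of "M$1$1 * M$2$2" "M$1$2 * M$2$1"]
    by (simp add: norm_mult mult.commute)
  also have "\<dots> \<le> sqrt (u\<^sup>2 + v\<^sup>2) * sqrt (w\<^sup>2 + z\<^sup>2)"
  proof -
    have "(u * z + v * w)\<^sup>2 \<le> (u\<^sup>2 + v\<^sup>2) * (w\<^sup>2 + z\<^sup>2)"
      using zero_le_power2[of "u * w - v * z"] by (simp add: power2_eq_square algebra_simps)
    then show ?thesis
      by (simp add: real_sqrt_mult[symmetric] real_le_rsqrt)
  qed
  also have "\<dots> \<le> onorm ((*v) M) * onorm ((*v) M)"
    using col[of 1] col[of 2] by (intro mult_mono) (auto simp: u_def v_def w_def z_def onorm_pos_le)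
  finally show ?thesis
    by (simp add: power2_eq_square)
qed

lemma scaleR_mat_mult:
  fixes A :: "'c::real_normed_field ^ 2 ^ 2"
  shows "A ** (r *\<^sub>R mat 1) = r *\<^sub>R A" and "(r *\<^sub>R mat 1) ** A = r *\<^sub>R A"
  by (simp_all add: vec_eq_iff forall_2 sum_2 matrix_matrix_mult_def mat_def)

text \<open>Conjugation by \<open>B\<close> preserves the trace and maps \<open>A\<close> to \<open>- A\<close>.\<close>

lemma trace_eq_0_of_anticommute:
  fixes A B :: "'c::real_normed_field ^ 2 ^ 2"
  assumes anti: "A ** B = - (B ** A)" and sq: "B ** B = \<beta> *\<^sub>R mat 1" and "\<beta> \<noteq> 0"
  shows "trace A = 0"
proof -
  have "trace (B ** (A ** B)) = trace ((A ** B) ** B)"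
    by (rule trace_mul_sym)
  also have "(A ** B) ** B = \<beta> *\<^sub>R A"
    by (simp add: matrix_mul_assoc[symmetric] sq scaleR_mat_mult)
  finally have 1: "trace (B ** (A ** B)) = \<beta> *\<^sub>R trace A"
    by (simp add: trace_def scaleR_sum_right)
  have "B ** (A ** B) = - (B ** (B ** A))"
    unfolding anti by (simp add: matrix_matrix_mult_def vec_eq_iff sum_negf)
  also have "B ** (B ** A) = (B ** B) ** A"
    by (rule matrix_mul_assoc)
  also have "(B ** B) ** A = \<beta> *\<^sub>R A"
    by (simp add: sq scaleR_mat_mult)
  finally have 2: "trace (B ** (A ** B)) = - (\<beta> *\<^sub>R trace A)"
    by (simp add: trace_def scaleR_sum_right sum_negf)
  from 1 2 have "\<beta> *\<^sub>R trace A + \<beta> *\<^sub>R trace A = 0"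
    by (simp add: eq_neg_iff_add_eq_0)
  then have "2 *\<^sub>R (\<beta> *\<^sub>R trace A) = 0"
    by (simp only: scaleR_2)
  then show ?thesis
    using \<open>\<beta> \<noteq> 0\<close> by simp
qed

text \<open>Covers both kinds of algebra: the entries are real for an indefinite and complex for a definite one.\<close>

locale real_matrix_rep =
  fixes a b :: rat and \<phi> :: "real quat \<Rightarrow> 'c::{real_normed_field, euclidean_space} ^ 2 ^ 2"
  assumes rep: "matrix_rep (Binf a b) \<phi>" and nonzero: "a \<noteq> 0" "b \<noteq> 0"
begin

abbreviation mul :: "real quat \<Rightarrow> real quat \<Rightarrow> real quat" where
  "mul \<equiv> qmul (of_rat a) (of_rat b)"

abbreviation nr :: "real quat \<Rightarrow> real" where
  "nr \<equiv> qnrd (of_rat a) (of_rat b)"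

lemma rep_add: "\<phi> (x + y) = \<phi> x + \<phi> y"
  and rep_mul: "\<phi> (mul x y) = \<phi> x ** \<phi> y"
  and rep_scale: "\<phi> (qscale r x) = r *\<^sub>R \<phi> x"
  and rep_one: "\<phi> (qof 1) = mat 1"
  using rep by (simp_all add: matrix_rep_def Binf_simps)

lemma rep_uminus: "\<phi> (- x) = - \<phi> x"
proof -
  have "- x = qscale (-1) x"
    by (simp add: quat_eq_iff)
  then show ?thesis
    by (simp add: rep_scale)
qed

lemma rep_diff: "\<phi> (x - y) = \<phi> x - \<phi> y"
  using rep_add[of x "- y"] by (simp add: rep_uminus)

lemma rep_qof: "\<phi> (qof r) = r *\<^sub>R mat 1"
proof -
  have "qof r = qscale r (qof 1)"
    by (simp add: quat_eq_iff)
  then show ?thesis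
    by (simp add: rep_scale rep_one)
qed

lemma trace_eq_0:
  assumes "mul x y = - mul y x" "mul y y = qof r" "r \<noteq> 0"
  shows "trace (\<phi> x) = 0"
proof (rule trace_eq_0_of_anticommute)
  show "\<phi> x ** \<phi> y = - (\<phi> y ** \<phi> x)"
    using arg_cong[OF assms(1), of \<phi>] by (simp add: rep_mul rep_uminus)
  show "\<phi> y ** \<phi> y = r *\<^sub>R mat 1"
    using arg_cong[OF assms(2), of \<phi>] by (simp add: rep_mul rep_qof)
qed fact

text \<open>Each of \<open>i\<close>, \<open>j\<close>, \<open>k\<close> anticommutes with an element whose square is a nonzero scalar and is
therefore mapped to a matrix of trace 0. So every representation turns the reduced trace into the
trace.\<close>

lemma trace_rep: "trace (\<phi> x) = of_real (2 * q_one x)"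
proof -
  have i: "trace (\<phi> (Quat 0 1 0 0)) = 0"
    by (rule trace_eq_0[of _ "Quat 0 0 1 0" "of_rat b"]) (simp_all add: quat_eq_iff qmul_def nonzero)
  have j: "trace (\<phi> (Quat 0 0 1 0)) = 0"
    by (rule trace_eq_0[of _ "Quat 0 1 0 0" "of_rat a"]) (simp_all add: quat_eq_iff qmul_def nonzero)
  have k: "trace (\<phi> (Quat 0 0 0 1)) = 0"
    by (rule trace_eq_0[of _ "Quat 0 1 0 0" "of_rat a"]) (simp_all add: quat_eq_iff qmul_def nonzero)
  have "x = qof (q_one x) + (qscale (q_i x) (Quat 0 1 0 0) + (qscale (q_j x) (Quat 0 0 1 0)
      + qscale (q_k x) (Quat 0 0 0 1)))"
    by (simp add: quat_eq_iff)
  then have "\<phi> x = \<phi> (qof (q_one x) + (qscale (q_i x) (Quat 0 1 0 0) + (qscale (q_j x) (Quat 0 0 1 0)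
      + qscale (q_k x) (Quat 0 0 0 1))))"
    by (rule arg_cong)
  also have "\<dots> = q_one x *\<^sub>R mat 1 + (q_i x *\<^sub>R \<phi> (Quat 0 1 0 0)
      + (q_j x *\<^sub>R \<phi> (Quat 0 0 1 0) + q_k x *\<^sub>R \<phi> (Quat 0 0 0 1)))"
    by (simp only: rep_add rep_scale rep_qof)
  finally have "trace (\<phi> x) = q_one x *\<^sub>R trace (mat 1 :: 'c ^ 2 ^ 2)
      + (q_i x *\<^sub>R trace (\<phi> (Quat 0 1 0 0)) + (q_j x *\<^sub>R trace (\<phi> (Quat 0 0 1 0))
      + q_k x *\<^sub>R trace (\<phi> (Quat 0 0 0 1))))"
    by (simp add: trace_def UNIV_2 algebra_simps)
  then show ?thesis
    unfolding i j k by (simp add: trace_def mat_def UNIV_2 scaleR_conv_of_real)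
qed

text \<open>As \<open>\<phi>\<close> respects traces, it maps the conjugate of \<open>x\<close> to the adjugate matrix of \<open>\<phi> x\<close>. Hence the
reduced norm becomes the determinant.\<close>

lemma det_rep: "det (\<phi> x) = of_real (nr x)"
proof -
  have "\<phi> (qconj x) = \<phi> (qof (2 * q_one x) - x)"
    by (rule arg_cong[of _ _ \<phi>]) (simp add: quat_eq_iff)
  then have conj: "\<phi> (qconj x) = (2 * q_one x) *\<^sub>R mat 1 - \<phi> x"
    by (simp add: rep_diff rep_qof)
  have "\<phi> x ** \<phi> (qconj x) = nr x *\<^sub>R mat 1"
    by (simp add: rep_mul[symmetric] qmul_qconj rep_qof)
  then have "(\<phi> x ** \<phi> (qconj x)) $ 1 $ 1 = of_real (nr x)"
    by (simp add: mat_def) (simp add: scaleR_conv_of_real)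
  then have "\<phi> x $ 1 $ 1 * (trace (\<phi> x) - \<phi> x $ 1 $ 1) - \<phi> x $ 1 $ 2 * \<phi> x $ 2 $ 1 = of_real (nr x)"
    by (simp add: conj matrix_matrix_mult_def sum_2 mat_def trace_rep)
       (simp add: scaleR_conv_of_real)
  then show ?thesis
    by (simp add: trace_def UNIV_2 det_2)
qed

lemma nrd_le_onorm_squared: "\<bar>nr x\<bar> \<le> (onorm ((*v) (\<phi> x)))\<^sup>2"
  using norm_det_le_onorm_squared[of "\<phi> x"] by (simp add: det_rep)

lemma onorm_diff_mul_le:
  "onorm ((*v) (\<phi> (x - mul y z))) \<le> onorm ((*v) (\<phi> x)) + onorm ((*v) (\<phi> y)) * onorm ((*v) (\<phi> z))"
proof -
  have bl: "bounded_linear (\<lambda>v. \<phi> y *v (\<phi> z *v v))"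
    by (rule bounded_linear_compose[OF matrix_vector_mul_bounded_linear matrix_vector_mul_bounded_linear])
  have "onorm ((*v) (\<phi> (x - mul y z))) = onorm (\<lambda>v. \<phi> x *v v + - (\<phi> y *v (\<phi> z *v v)))"
    by (rule arg_cong[of _ _ onorm], rule ext) (simp add: rep_diff rep_mul matrix_vector_mult_diff_rdistrib matrix_vector_mul_assoc)
  also have "\<dots> \<le> onorm ((*v) (\<phi> x)) + onorm (\<lambda>v. - (\<phi> y *v (\<phi> z *v v)))"
    by (rule onorm_triangle[OF matrix_vector_mul_bounded_linear bounded_linear_minus[OF bl]])
  also have "onorm (\<lambda>v. - (\<phi> y *v (\<phi> z *v v))) = onorm ((*v) (\<phi> y) \<circ> (*v) (\<phi> z))"
    by (simp add: onorm_neg o_def)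
  also have "\<dots> \<le> onorm ((*v) (\<phi> y)) * onorm ((*v) (\<phi> z))"
    by (rule onorm_compose[OF matrix_vector_mul_bounded_linear matrix_vector_mul_bounded_linear])
  finally show ?thesis
    by simp
qed

end

lemma archimedean_norm_properties:
  assumes norm: "archimedean_norm a b N" and ab: "a \<noteq> 0" "b \<noteq> 0"
  shows "N x \<ge> 0"
    and "\<bar>qnrd (of_rat a) (of_rat b) x\<bar> \<le> (N x)\<^sup>2"
    and "N (x - qmul (of_rat a) (of_rat b) y z) \<le> N x + N y * N z"
proof -
  have "N x \<ge> 0 \<and> \<bar>qnrd (of_rat a) (of_rat b) x\<bar> \<le> (N x)\<^sup>2 \<and>
      N (x - qmul (of_rat a) (of_rat b) y z) \<le> N x + N y * N z"
  proof (cases "definite a b")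
    case True
    then obtain \<phi> :: "real quat \<Rightarrow> complex ^ 2 ^ 2"
      where \<phi>: "matrix_rep (Binf a b) \<phi>" "\<And>x. N x = onorm ((*v) (\<phi> x))"
      using norm by (auto simp: archimedean_norm_def Binf_simps)
    interpret real_matrix_rep a b \<phi>
      by unfold_locales (use \<phi> ab in auto)
    show ?thesis
      unfolding \<phi>(2) using nrd_le_onorm_squared onorm_diff_mul_le by (auto intro: onorm_pos_le)
  next
    case False
    then obtain \<phi> :: "real quat \<Rightarrow> real ^ 2 ^ 2"
      where \<phi>: "matrix_rep (Binf a b) \<phi>" "\<And>x. N x = onorm ((*v) (\<phi> x))"
      using norm by (auto simp: archimedean_norm_def Binf_simps)
    interpret real_matrix_rep a b \<phi>
      by unfold_locales (use \<phi> ab in auto)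
    show ?thesis
      unfolding \<phi>(2) using nrd_le_onorm_squared onorm_diff_mul_le by (auto intro: onorm_pos_le)
  qed
  then show "N x \<ge> 0" "\<bar>qnrd (of_rat a) (of_rat b) x\<bar> \<le> (N x)\<^sup>2"
    "N (x - qmul (of_rat a) (of_rat b) y z) \<le> N x + N y * N z"
    by blast+
qed

lemma to_Binf_sel [simp]:
  "q_one (to_Binf x) = of_rat (q_one x)" "q_i (to_Binf x) = of_rat (q_i x)"
  "q_j (to_Binf x) = of_rat (q_j x)" "q_k (to_Binf x) = of_rat (q_k x)"
  by (cases x; simp)+

lemma to_Binf_diff: "to_Binf (x - y) = to_Binf x - to_Binf y"
  by (simp add: quat_eq_iff of_rat_diff)

lemma to_Binf_qmul: "to_Binf (qmul a b x y) = qmul (of_rat a) (of_rat b) (to_Binf x) (to_Binf y)"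
  by (simp add: quat_eq_iff qmul_def of_rat_diff of_rat_add of_rat_mult)

lemma qnrd_to_Binf: "qnrd (of_rat a) (of_rat b) (to_Binf x) = of_rat (qnrd a b x)"
  by (simp add: qnrd_def of_rat_diff of_rat_add of_rat_mult)

section \<open>Growth of continuants\<close>

text \<open>\<open>theta\<close> of \<open>h\<close> is the positive root of \<open>X\<^sup>2 = h X + 1\<close>.\<close>

lemma theta_of_real:
  assumes "h \<ge> 0"
  shows "theta (of_real h) > 0"
    and "(theta (of_real h))\<^sup>2 = h * theta (of_real h) + 1"
proof -
  define S where "S = sqrt (h\<^sup>2 + 4)"
  have S: "S\<^sup>2 = h\<^sup>2 + 4" "S > 0"
    by (simp_all add: S_def add_nonneg_pos)
  have th: "theta (of_real h) = (h + S) / 2"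
    using assms by (simp add: theta_def S_def)
  show "theta (of_real h) > 0"
    using assms S(2) by (simp add: th)
  show "(theta (of_real h))\<^sup>2 = h * theta (of_real h) + 1"
    unfolding th using S(1) by (simp add: power2_eq_square field_simps)
qed

text \<open>The symmetric matrix with rows \<open>(h, 1)\<close> and \<open>(1, 0)\<close> has characteristic polynomial
\<open>X\<^sup>2 - h X - 1\<close>; its largest eigenvalue \<open>theta h\<close> is therefore its Euclidean operator norm.
The matrix maps \<open>(v, u)\<close> to \<open>(h v + u, v)\<close>.\<close>

lemma continuant_step:
  fixes u v w h :: real
  assumes "u \<ge> 0" "v \<ge> 0" "h \<ge> 0" "w \<ge> 0" "w \<le> u + h * v"
  shows "sqrt (w\<^sup>2 + v\<^sup>2) \<le> theta (of_real h) * sqrt (v\<^sup>2 + u\<^sup>2)"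
proof -
  define t where "t = theta (of_real h)"
  have t: "t > 0" "t\<^sup>2 = h * t + 1"
    using theta_of_real[OF assms(3)] by (simp_all add: t_def)
  (* since t - h = 1 / t, the quadratic form on the left is a multiple of a square *)
  have "t * (t * u\<^sup>2 - 2 * u * v + (t - h) * v\<^sup>2) = (t * u - v)\<^sup>2 + (t\<^sup>2 - h * t - 1) * v\<^sup>2"
    by (simp add: power2_eq_square algebra_simps)
  also have "\<dots> = (t * u - v)\<^sup>2"
    by (simp add: t(2))
  finally have "t * (t * u\<^sup>2 - 2 * u * v + (t - h) * v\<^sup>2) \<ge> 0"
    by simp
  then have "t * u\<^sup>2 - 2 * u * v + (t - h) * v\<^sup>2 \<ge> 0"
    using t(1) by (simp add: zero_le_mult_iff)
  then have "h * (t * u\<^sup>2 - 2 * u * v + (t - h) * v\<^sup>2) \<ge> 0"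
    using assms(3) by simp
  moreover have "t\<^sup>2 * (v\<^sup>2 + u\<^sup>2) - ((u + h * v)\<^sup>2 + v\<^sup>2) = h * (t * u\<^sup>2 - 2 * u * v + (t - h) * v\<^sup>2)"
    unfolding t(2) by (simp add: power2_eq_square algebra_simps)
  moreover have "w\<^sup>2 \<le> (u + h * v)\<^sup>2"
    using assms by (intro power_mono) auto
  ultimately have "w\<^sup>2 + v\<^sup>2 \<le> t\<^sup>2 * (v\<^sup>2 + u\<^sup>2)"
    by linarith
  then have "sqrt (w\<^sup>2 + v\<^sup>2) \<le> sqrt (t\<^sup>2 * (v\<^sup>2 + u\<^sup>2))"
    by (rule real_sqrt_le_mono)
  then show ?thesis
    using t(1) by (simp add: real_sqrt_mult t_def)
qed

section \<open>The remainders of a rational element\<close>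

text \<open>The Euclidean algorithm applied to \<open>\<alpha>\<close> and 1 with quotients \<open>c 0, c 1, ...\<close>. These remainders are
used in place of the numerators and denominators of the convergents: the p-adic size of a
remainder is an exact product, as \<open>qmul_remainder\<close> shows.\<close>

fun remainder :: "rat \<Rightarrow> rat \<Rightarrow> rat quat \<Rightarrow> (nat \<Rightarrow> rat quat) \<Rightarrow> nat \<Rightarrow> rat quat" where
  "remainder a b \<alpha> c 0 = \<alpha>"
| "remainder a b \<alpha> c (Suc 0) = qof 1"
| "remainder a b \<alpha> c (Suc (Suc n)) =
     remainder a b \<alpha> c n - qmul a b (c n) (remainder a b \<alpha> c (Suc n))"

text \<open>A rational starting point keeps the algorithm inside the rational algebra, because the floor
function takes rational values.\<close>

lemma (in division_at_prime) rational_complete_quotients: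
  assumes cf: "has_infinite_cf a b p s (to_Bp p \<alpha>) c"
  obtains x where "x 0 = \<alpha>" and "\<And>n. c n = s (to_Bp p (x n))" and "\<And>n. x n \<noteq> c n"
    and "\<And>n. x (Suc n) = qinv a b (x n - c n)"
proof -
  have step: "z \<noteq> c n \<and> c n = s (to_Bp p z) \<and>
      complete_quotient a b p s (to_Bp p \<alpha>) (Suc n) = Some (to_Bp p (qinv a b (z - c n)))"
    if z: "complete_quotient a b p s (to_Bp p \<alpha>) n = Some (to_Bp p z)" for n z
  proof -
    have c: "c n = s (to_Bp p z)"
      using cf[unfolded has_infinite_cf_def, THEN spec, of n] z by (simp add: partial_quotient_def)
    have "complete_quotient a b p s (to_Bp p \<alpha>) (Suc n) \<noteq> None"
      using cf unfolding has_infinite_cf_def partial_quotient_def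
      by (metis map_option_is_None option.distinct(1))
    then have ne: "to_Bp p z \<noteq> to_Bp p (c n)"
      using z c by (auto split: if_splits)
    then have "z \<noteq> c n"
      by auto
    then show ?thesis
      using z c ne by (simp add: to_Bp_diff to_Bp_inv)
  qed
  define x where "x = rec_nat \<alpha> (\<lambda>n z. qinv a b (z - c n))"
  have x0: "x 0 = \<alpha>" and xS: "x (Suc n) = qinv a b (x n - c n)" for n
    by (simp_all add: x_def)
  have "complete_quotient a b p s (to_Bp p \<alpha>) n = Some (to_Bp p (x n))" for n
    by (induction n) (use step x0 xS in \<open>auto simp del: complete_quotient.simps(2)\<close>)
  then have "x n \<noteq> c n \<and> c n = s (to_Bp p (x n))" for n
    using step by blast
  then show ?thesis
    using that x0 xS by blast
qed

lemma (in division_at_prime) qmul_remainder: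
  assumes "x 0 = \<alpha>" and "\<And>n. x n \<noteq> c n" and "\<And>n. x (Suc n) = qinv a b (x n - c n)"
  shows "qmul a b (x n) (remainder a b \<alpha> c (Suc n)) = remainder a b \<alpha> c n"
proof (induction n)
  case 0
  then show ?case
    by (simp add: assms(1))
next
  case (Suc n)
  have "remainder a b \<alpha> c (Suc (Suc n)) = qmul a b (x n - c n) (remainder a b \<alpha> c (Suc n))"
    using Suc by (simp add: qmul_diff_left)
  then have "qmul a b (x (Suc n)) (remainder a b \<alpha> c (Suc (Suc n))) =
      qmul a b (qmul a b (qinv a b (x n - c n)) (x n - c n)) (remainder a b \<alpha> c (Suc n))"
    by (simp only: assms(3) qmul_assoc)
  then show ?case
    using assms(2)[of n] by (simp add: qinv_qmul)
qed

lemma (in division_at_prime) remainder_nonzero: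
  assumes "x 0 = \<alpha>" and "\<And>n. x n \<noteq> c n" and "\<And>n. x (Suc n) = qinv a b (x n - c n)"
  shows "remainder a b \<alpha> c (Suc n) \<noteq> 0"
proof (induction n)
  case 0
  then show ?case
    by (simp add: quat_eq_iff)
next
  case (Suc n)
  have "remainder a b \<alpha> c (Suc (Suc n)) = qmul a b (x n - c n) (remainder a b \<alpha> c (Suc n))"
    using qmul_remainder[of x \<alpha> c n, OF assms] by (simp add: qmul_diff_left)
  then have "qnrd a b (remainder a b \<alpha> c (Suc (Suc n))) \<noteq> 0"
    using Suc assms(2)[of n] by (simp add: qnrd_qmul del: remainder.simps)
  then show ?case
    by auto
qed

text \<open>The recursion multiplies only by elements of \<open>R[1/p]\<close>, so that the denominators introduced by \<open>\<alpha>\<close>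
itself are the only ones.\<close>

lemma (in quaternion_order) remainder_denominator:
  assumes c: "\<And>n. c n \<in> R_away p"
  obtains e :: int where "e > 0" "\<And>n. qscale (of_int e) (remainder a b \<alpha> c n) \<in> R_away p"
proof -
  obtain e where e: "e > 0" "qscale (of_int e) \<alpha> \<in> R"
    using R_full by blast
  have "qscale (of_int e) (remainder a b \<alpha> c n) \<in> R_away p \<and>
      qscale (of_int e) (remainder a b \<alpha> c (Suc n)) \<in> R_away p" for n
  proof (induction n)
    case 0
    then show ?case
      using R_subset_R_away[of p] e(2) R_scale[OF R_one, of e] by auto
  next
    case (Suc n)
    have "qscale (of_int e) (remainder a b \<alpha> c (Suc (Suc n))) =
        qscale (of_int e) (remainder a b \<alpha> c n) -
        qmul a b (c n) (qscale (of_int e) (remainder a b \<alpha> c (Suc n)))"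
      by (simp add: qscale_diff_right qmul_qscale_right)
    also have "\<dots> \<in> R_away p"
      using Suc c by (intro R_away_diff R_away_mult) auto
    finally show ?case
      using Suc by blast
  qed
  then show ?thesis
    using that e(1) by blast
qed

theorem theorem5p2:
  fixes a b :: rat and R :: "rat quat set" and p :: nat
    and s :: "padic quat \<Rightarrow> rat quat"
    and N :: "real quat \<Rightarrow> real"
    and \<alpha> :: "rat quat" and c :: "nat \<Rightarrow> rat quat" and \<mu> :: real
  assumes type: "quaternionic_type a b R p s"
    and norm: "archimedean_norm a b N"
    and alpha: "\<alpha> \<in> carrier (BQ a b)"
    and cf: "has_infinite_cf a b p s (to_Bp p \<alpha>) c"
    and bound: "\<forall>\<^sub>F n in sequentially.
      theta (complex_of_real (N (to_Binf (c n)))) / abs_Bp a b p (to_Bp p (c n)) \<le> \<mu>"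
  shows "\<mu> \<ge> 1"
proof (rule ccontr)
  assume "\<not> \<mu> \<ge> 1"
  then have \<mu>1: "\<mu> < 1"
    by simp
  have ab: "a \<noteq> 0" "b \<noteq> 0" and floor: "padic_floor a b R p s"
    and p: "Factorial_Ring.prime p"
    using type by (simp_all add: quaternionic_type_def)
  interpret division_at_prime p a b
    by unfold_locales (use type in \<open>simp_all add: quaternionic_type_def\<close>)
  interpret quaternion_order a b R
    by unfold_locales (use type in \<open>simp add: quaternionic_type_def\<close>)
  note N = archimedean_norm_properties[OF norm ab]
  obtain x where x0: "x 0 = \<alpha>" and c: "\<And>n. c n = s (to_Bp p (x n))"
    and ne: "\<And>n. x n \<noteq> c n" and xS: "\<And>n. x (Suc n) = qinv a b (x n - c n)"
    using rational_complete_quotients[OF cf] by blast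
  have carr: "to_Bp p z \<in> carrier (Bp a b p)" for z
    by (simp add: to_Bp_qcls)
  have frac: "av (qnrd a b (x n - c n)) < 1" for n
  proof -
    have "abs_Bp a b p (to_Bp p (x n) \<ominus>\<^bsub>Bp a b p\<^esub> to_Bp p (c n)) < 1"
      using floor carr unfolding padic_floor_def c by blast
    then show ?thesis
      by (simp add: to_Bp_diff abs_Bp_to_Bp)
  qed
  have c_away: "c n \<in> R_away p" for n
  proof (rule R_away_if_R_at[OF p])
    fix q :: nat
    assume q: "Factorial_Ring.prime q" "q \<noteq> p"
    interpret Q: order_at_prime q a b R
      by unfold_locales (rule q)
    show "c n \<in> R_at q"
      using floor carr q unfolding padic_floor_def c
      by (intro Q.R_at_if_in_order_completion) blast
  qed

  (* r and T are the p-adic and the archimedean size of the remainders. The product r * t is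
     multiplied by at most \<mu> in each step. Consecutive values are combined in t because
     only this vector grows by the factor theta. *)
  define \<xi> where "\<xi> = remainder a b \<alpha> c"
  define A where "A n = sqrt (av (qnrd a b (c n)))" for n
  define r where "r n = sqrt (av (qnrd a b (\<xi> n)))" for n
  define T where "T n = N (to_Binf (\<xi> n))" for n
  define \<theta> where "\<theta> n = theta (of_real (N (to_Binf (c n))))" for n
  define t where "t n = sqrt ((T (Suc n))\<^sup>2 + (T n)\<^sup>2)" for n

  have x_norm: "av (qnrd a b (x (Suc n))) > 1" for n
    using frac[of n] ne[of n] by (simp add: xS qnrd_qinv one_less_inverse)
  (* a complete quotient with index at least 1 is large and differs from its floor by a small
     element, so that both have the same size *)
  have A_eq: "av (qnrd a b (c (Suc n))) = av (qnrd a b (x (Suc n)))" for n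
  proof (rule antisym)
    show "av (qnrd a b (c (Suc n))) \<le> av (qnrd a b (x (Suc n)))"
      using av_qnrd_add_le_max[of "x (Suc n)" "- (x (Suc n) - c (Suc n))"]
        frac[of "Suc n"] x_norm[of n] unfolding qnrd_uminus by simp
    show "av (qnrd a b (x (Suc n))) \<le> av (qnrd a b (c (Suc n)))"
      using av_qnrd_add_le_max[of "c (Suc n)" "x (Suc n) - c (Suc n)"]
        frac[of "Suc n"] x_norm[of n] by simp
  qed
  have A_pos: "A (Suc n) > 0" for n
    using x_norm[of n] unfolding A_def A_eq real_sqrt_gt_0_iff by linarith
  have r_step: "A (Suc n) * r (Suc (Suc n)) = r (Suc n)" for n
  proof -
    have "qmul a b (x (Suc n)) (\<xi> (Suc (Suc n))) = \<xi> (Suc n)"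
      unfolding \<xi>_def by (rule qmul_remainder[of x \<alpha> c, OF x0 ne xS])
    then have "av (qnrd a b (x (Suc n))) * av (qnrd a b (\<xi> (Suc (Suc n)))) = av (qnrd a b (\<xi> (Suc n)))"
      by (simp add: qnrd_qmul[symmetric] av_mult[symmetric] del: av_mult)
    then show ?thesis
      by (simp add: A_def r_def A_eq real_sqrt_mult[symmetric])
  qed
  have T_nonneg: "T n \<ge> 0" for n
    by (simp add: T_def N(1))
  have T_step: "T (Suc (Suc n)) \<le> T n + N (to_Binf (c n)) * T (Suc n)" for n
    using N(3)[of "to_Binf (\<xi> n)" "to_Binf (c n)" "to_Binf (\<xi> (Suc n))"]
    by (simp add: T_def \<xi>_def to_Binf_diff to_Binf_qmul)
  have t_step: "t (Suc n) \<le> \<theta> n * t n" for n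
    unfolding t_def \<theta>_def using T_nonneg T_step N(1) by (intro continuant_step)
  have P_step: "r (Suc (Suc n)) * t (Suc (Suc n)) \<le> \<mu> * (r (Suc n) * t (Suc n))"
    if "\<theta> (Suc n) / A (Suc n) \<le> \<mu>" for n
  proof -
    have "\<theta> (Suc n) \<le> \<mu> * A (Suc n)"
      using that A_pos[of n] by (simp add: divide_le_eq)
    then have "\<theta> (Suc n) * t (Suc n) \<le> \<mu> * A (Suc n) * t (Suc n)"
      by (intro mult_right_mono) (simp_all add: t_def)
    then have "t (Suc (Suc n)) \<le> \<mu> * A (Suc n) * t (Suc n)"
      using t_step[of "Suc n"] by linarith
    then have "r (Suc (Suc n)) * t (Suc (Suc n)) \<le> r (Suc (Suc n)) * (\<mu> * A (Suc n) * t (Suc n))"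
      by (intro mult_left_mono) (simp_all add: r_def)
    also have "\<dots> = \<mu> * (r (Suc n) * t (Suc n))"
      unfolding r_step[of n, symmetric] by (simp add: mult_ac)
    finally show ?thesis .
  qed
  obtain m where m: "\<And>n. n \<ge> m \<Longrightarrow> \<theta> n / A n \<le> \<mu>"
    using bound unfolding eventually_sequentially abs_Bp_to_Bp \<theta>_def A_def by blast
  have "0 < \<theta> (Suc m) / A (Suc m)"
    using A_pos[of m] theta_of_real(1)[OF N(1)] by (simp add: \<theta>_def)
  then have \<mu>0: "\<mu> > 0"
    using m[of "Suc m"] by linarith
  have P_le: "r (Suc m + k) * t (Suc m + k) \<le> \<mu> ^ k * (r (Suc m) * t (Suc m))" for k
  proof (induction k)
    case (Suc k)
    have "r (Suc m + Suc k) * t (Suc m + Suc k) \<le> \<mu> * (r (Suc m + k) * t (Suc m + k))"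
      using P_step[of "m + k"] m[of "Suc (m + k)"] by simp
    also have "\<dots> \<le> \<mu> * (\<mu> ^ k * (r (Suc m) * t (Suc m)))"
      using Suc \<mu>0 by (intro mult_left_mono) auto
    finally show ?case
      by (simp add: mult.assoc)
  qed simp

  obtain \<epsilon> where \<epsilon>: "\<epsilon> > 0"
    "\<And>x. x \<in> R_away p \<Longrightarrow> qnrd a b x \<noteq> 0 \<Longrightarrow> av (qnrd a b x) * \<bar>real_of_rat (qnrd a b x)\<bar> \<ge> \<epsilon>"
    using R_away_product_formula[OF p] by blast
  obtain e :: int where e: "e > 0" "\<And>n. qscale (of_int e) (\<xi> n) \<in> R_away p"
    unfolding \<xi>_def by (rule remainder_denominator[of c p \<alpha>, OF c_away]) blast
  (* multiplication by e clears the denominators of \<alpha>, at the cost of a constant factor *)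
  have lower: "(r (Suc n) * t (Suc n))\<^sup>2 \<ge> \<epsilon> / (of_int e)\<^sup>2" for n
  proof -
    define \<nu> where "\<nu> = qnrd a b (\<xi> (Suc n))"
    have "\<nu> \<noteq> 0"
      unfolding \<nu>_def \<xi>_def using remainder_nonzero[of x \<alpha> c, OF x0 ne xS] by simp
    then have "\<epsilon> \<le> av ((of_int e)\<^sup>2 * \<nu>) * \<bar>real_of_rat ((of_int e)\<^sup>2 * \<nu>)\<bar>"
      using \<epsilon>(2)[OF e(2)[of "Suc n"]] e(1) unfolding qnrd_qscale \<nu>_def by simp
    also have "\<dots> = (av (of_int e))\<^sup>2 * (av \<nu> * ((of_int e)\<^sup>2 * \<bar>real_of_rat \<nu>\<bar>))"
      by (simp add: of_rat_mult of_rat_power abs_mult)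
    also have "\<dots> \<le> 1 * (av \<nu> * ((of_int e)\<^sup>2 * \<bar>real_of_rat \<nu>\<bar>))"
      by (intro mult_right_mono power_le_one) auto
    also have "\<dots> \<le> 1 * (av \<nu> * ((of_int e)\<^sup>2 * (T (Suc n))\<^sup>2))"
      using N(2)[of "to_Binf (\<xi> (Suc n))"]
      by (intro mult_left_mono) (auto simp: T_def \<nu>_def qnrd_to_Binf)
    also have "\<dots> \<le> 1 * (av \<nu> * ((of_int e)\<^sup>2 * (t (Suc n))\<^sup>2))"
      by (intro mult_left_mono) (auto simp: t_def)
    also have "\<dots> = (r (Suc n) * t (Suc n))\<^sup>2 * (of_int e)\<^sup>2"
      by (simp add: r_def \<nu>_def power_mult_distrib)
    finally show ?thesis
      using e(1) by (simp add: divide_le_eq)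
  qed
  have "(\<lambda>k. (\<mu> ^ k * (r (Suc m) * t (Suc m)))\<^sup>2) \<longlonglongrightarrow> (0 * (r (Suc m) * t (Suc m)))\<^sup>2"
    using \<mu>0 \<mu>1 by (intro tendsto_intros LIMSEQ_realpow_zero) auto
  then have limit: "(\<lambda>k. (\<mu> ^ k * (r (Suc m) * t (Suc m)))\<^sup>2) \<longlonglongrightarrow> 0"
    by simp
  have "\<epsilon> / (of_int e)\<^sup>2 \<le> (\<mu> ^ k * (r (Suc m) * t (Suc m)))\<^sup>2" for k
  proof -
    have "(r (Suc m + k) * t (Suc m + k))\<^sup>2 \<le> (\<mu> ^ k * (r (Suc m) * t (Suc m)))\<^sup>2"
      using P_le by (intro power_mono) (auto simp: r_def t_def)
    then show ?thesis
      using lower[of "m + k"] by simp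
  qed
  then have "\<epsilon> / (of_int e)\<^sup>2 \<le> 0"
    by (intro LIMSEQ_le_const[OF limit]) blast
  then show False
    using \<epsilon>(1) e(1) by (simp add: divide_le_0_iff)
qed

end
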